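(* Let $G$ be a finite group and let $V$ be a finite-dimensional representation of $G$ over a field $\Bbbk$. If there exists a geometric separating algebra $A\subseteq \Bbbk[V]^G$ which is a polynomial ring, then the action of $G$ on $V$ is generated by reflections.
   Context: $\Bbbk[V]$ denotes the symmetric algebra on the dual space $V^*$ (a polynomial ring with its standard grading), with $G$ acting by $(\sigma\cdot f)(u)=f(\sigma^{-1}u)$; $\Bbbk[V]^G$ is the ring of invariants. Let $\overline{\Bbbk}$ be an algebraic closure of $\Bbbk$ and $\overline V=V\otimes_\Bbbk\overline{\Bbbk}$, with the extended $G$-action; elements of $\Bbbk[V]$ are regarded as functions $\overline V\to\overline{\Bbbk}$. A subalgebra $A\subseteq\Bbbk[V]^G$ is a geometric separating algebra if for all $u,v\in\overline V$: $f(u)=f(v)$ for all $f\in\Bbbk[V]^G$ if and only if $h(u)=h(v)$ for all $h\in A$. A reflection is an element of $G$ acting on $V$ so as to fix (pointwise) a subspace of codimension $1$ in $V$; "the action is generated by reflections" means the image of $G$ in $GL(V)$ is generated by the images of such elements. *)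

theory Defs
  imports "HOL-Algebra.Generated_Groups" "HOL-Library.Poly_Mapping"
    "Jordan_Normal_Form.Matrix" "HOL-Computational_Algebra.Polynomial"
begin

text \<open>Multivariate polynomials over 'k in the variables x_0, x_1, ... :
  finitely supported maps from monomials (exponent vectors nat =>0 nat) to coefficients.
  The ring structure (comm_ring_1) is the one of HOL-Library.Poly_Mapping.\<close>
type_synonym 'k mpoly = "(nat \<Rightarrow>\<^sub>0 nat) \<Rightarrow>\<^sub>0 'k"

definition mconst :: "'k::comm_ring_1 \<Rightarrow> 'k mpoly" where
  "mconst c = Poly_Mapping.single 0 c"

definition mvar :: "nat \<Rightarrow> 'k::comm_ring_1 mpoly" where
  "mvar i = Poly_Mapping.single (Poly_Mapping.single i 1) 1"

definition mvars :: "'k::zero mpoly \<Rightarrow> nat set" where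
  "mvars f = (\<Union>m\<in>Poly_Mapping.keys f. Poly_Mapping.keys m)"

definition msubst :: "(nat \<Rightarrow> 'k::comm_ring_1 mpoly) \<Rightarrow> 'k mpoly \<Rightarrow> 'k mpoly" where
  "msubst g f = (\<Sum>m\<in>Poly_Mapping.keys f. mconst (Poly_Mapping.lookup f m) * (\<Prod>i\<in>Poly_Mapping.keys m. g i ^ Poly_Mapping.lookup m i))"

text \<open>Evaluation of a polynomial over 'k at a point u (a vector over an extension field 'K,
  with the embedding iota of 'k into 'K); variable x_i is the i-th coordinate function.\<close>
definition meval :: "('k::comm_ring_1 \<Rightarrow> 'K::comm_ring_1) \<Rightarrow> 'k mpoly \<Rightarrow> 'K vec \<Rightarrow> 'K" where
  "meval \<iota> f u = (\<Sum>m\<in>Poly_Mapping.keys f. \<iota> (Poly_Mapping.lookup f m) * (\<Prod>i\<in>Poly_Mapping.keys m. (u $ i) ^ Poly_Mapping.lookup m i))"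

definition coord_ring :: "nat \<Rightarrow> 'k::comm_ring_1 mpoly set" where
  "coord_ring n = {f. mvars f \<subseteq> {..<n}}"

definition lin_rep :: "('g, 'b) monoid_scheme \<Rightarrow> nat \<Rightarrow> ('g \<Rightarrow> 'k::comm_ring_1 mat) \<Rightarrow> bool" where
  "lin_rep G n \<rho> \<longleftrightarrow>
     (\<forall>\<sigma>\<in>carrier G. \<rho> \<sigma> \<in> carrier_mat n n) \<and>
     \<rho> \<one>\<^bsub>G\<^esub> = 1\<^sub>m n \<and>
     (\<forall>\<sigma>\<in>carrier G. \<forall>\<tau>\<in>carrier G. \<rho> (\<sigma> \<otimes>\<^bsub>G\<^esub> \<tau>) = \<rho> \<sigma> * \<rho> \<tau>)"

text \<open>Action on k[V]: (sigma . f)(u) = f(rho(sigma^-1) u), i.e. substitute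
  x_i := sum_j rho(sigma^-1)_{ij} x_j.\<close>
definition poly_act :: "('g, 'b) monoid_scheme \<Rightarrow> nat \<Rightarrow> ('g \<Rightarrow> 'k::comm_ring_1 mat) \<Rightarrow> 'g \<Rightarrow> 'k mpoly \<Rightarrow> 'k mpoly" where
  "poly_act G n \<rho> \<sigma> f =
     msubst (\<lambda>i. \<Sum>j<n. mconst (\<rho> (inv\<^bsub>G\<^esub> \<sigma>) $$ (i, j)) * mvar j) f"

definition invariant_ring :: "('g, 'b) monoid_scheme \<Rightarrow> nat \<Rightarrow> ('g \<Rightarrow> 'k::comm_ring_1 mat) \<Rightarrow> 'k mpoly set" where
  "invariant_ring G n \<rho> = {f \<in> coord_ring n. \<forall>\<sigma>\<in>carrier G. poly_act G n \<rho> \<sigma> f = f}"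

definition is_subalgebra :: "'k::comm_ring_1 mpoly set \<Rightarrow> bool" where
  "is_subalgebra A \<longleftrightarrow> (\<forall>c. mconst c \<in> A) \<and>
     (\<forall>f\<in>A. \<forall>g\<in>A. f + g \<in> A \<and> f * g \<in> A)"

definition is_polynomial_ring :: "'k::comm_ring_1 mpoly set \<Rightarrow> bool" where
  "is_polynomial_ring A \<longleftrightarrow>
     (\<exists>r::nat. \<exists>F::nat \<Rightarrow> 'k mpoly.
        (\<forall>i<r. F i \<in> A) \<and>
        A = {msubst F p | p. p \<in> coord_ring r} \<and>
        (\<forall>p\<in>coord_ring r. msubst F p = 0 \<longrightarrow> p = 0))"

definition is_alg_closure :: "('k::field \<Rightarrow> 'K::field) \<Rightarrow> bool" where
  "is_alg_closure \<iota> \<longleftrightarrow>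
     inj \<iota> \<and> \<iota> 1 = 1 \<and> (\<forall>a b. \<iota> (a + b) = \<iota> a + \<iota> b \<and> \<iota> (a * b) = \<iota> a * \<iota> b) \<and>
     (\<forall>p::'K poly. degree p > 0 \<longrightarrow> (\<exists>x. poly p x = 0)) \<and>
     (\<forall>x::'K. \<exists>p::'k poly. p \<noteq> 0 \<and> poly (map_poly \<iota> p) x = 0)"

definition geom_separating ::
  "('k::field \<Rightarrow> 'K::field) \<Rightarrow> ('g, 'b) monoid_scheme \<Rightarrow> nat \<Rightarrow> ('g \<Rightarrow> 'k mat) \<Rightarrow> 'k mpoly set \<Rightarrow> bool" where
  "geom_separating \<iota> G n \<rho> A \<longleftrightarrow>
     A \<subseteq> invariant_ring G n \<rho> \<and> is_subalgebra A \<and>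
     (\<forall>u\<in>carrier_vec n. \<forall>v\<in>carrier_vec n.
        (\<forall>f\<in>invariant_ring G n \<rho>. meval \<iota> f u = meval \<iota> f v) \<longleftrightarrow>
        (\<forall>h\<in>A. meval \<iota> h u = meval \<iota> h v))"

definition is_reflection :: "('g, 'b) monoid_scheme \<Rightarrow> nat \<Rightarrow> ('g \<Rightarrow> 'k::field mat) \<Rightarrow> 'g \<Rightarrow> bool" where
  "is_reflection G n \<rho> \<sigma> \<longleftrightarrow> \<sigma> \<in> carrier G \<and>
     (\<exists>a\<in>carrier_vec n. a \<noteq> 0\<^sub>v n \<and>
        (\<forall>u\<in>carrier_vec n. a \<bullet> u = 0 \<longrightarrow> \<rho> \<sigma> *\<^sub>v u = u))"

definition generated_by_reflections :: "('g, 'b) monoid_scheme \<Rightarrow> nat \<Rightarrow> ('g \<Rightarrow> 'k::field mat) \<Rightarrow> bool" where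
  "generated_by_reflections G n \<rho> \<longleftrightarrow>
     \<rho> ` carrier G = \<rho> ` generate G {\<sigma>. is_reflection G n \<rho> \<sigma>}"

end

theory Submission
  imports Defs "Jordan_Normal_Form.Char_Poly"
begin

text \<open>Let \<open>F\<^sub>1, \<dots>, F\<^sub>r\<close> be algebraically independent generators of the separating algebra, so \<open>r \<le> n\<close>.
  The zero set in \<open>V \<times> V\<close> of the ideal \<open>I = (F\<^sub>i(y) - F\<^sub>i(x))\<close> is the union of the graphs of the
  elements of \<open>G\<close>, hence a set-theoretic complete intersection, and Hartshorne's connectedness
  argument applies. If the subgroup \<open>H\<close> generated by reflections were proper, the graphs over \<open>H\<close>
  and the remaining graphs would meet in codimension at least two. This yields coprime
  \<open>s = A\<^sub>1 + B\<^sub>1\<close> and \<open>t = A\<^sub>2 + B\<^sub>2\<close> in \<open>k[x]\<close>, where the \<open>B\<^sub>i\<close> vanish on the graphs over \<open>H\<close>, the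
  \<open>A\<^sub>i\<close> vanish on the remaining ones, and \<open>A\<^sub>1 B\<^sub>1\<close>, \<open>A\<^sub>1 B\<^sub>2\<close>, \<open>A\<^sub>2 B\<^sub>1\<close> lie in \<open>I\<close>. By the
  Nullstellensatz \<open>I\<close> contains, for each \<open>i\<close>, a polynomial that is monic in \<open>y\<^sub>i\<close> over \<open>k[x]\<close>;
  together with \<open>s\<close> and \<open>t\<close> these form a regular sequence of length \<open>n + 2\<close> in \<open>I + (s, t)\<close>, so the
  Koszul complex of the \<open>n + 2\<close> generators of this ideal is exact in degree one. The relation
  \<open>A\<^sub>1 t - A\<^sub>2 s \<in> I\<close> therefore gives \<open>A\<^sub>1 \<in> e s + I\<close>, and \<open>e\<close> is idempotent modulo \<open>I\<close>. Such an \<open>e\<close>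
  is constant on every graph, with the same value at the origin, yet it is \<open>1\<close> on the graphs over
  \<open>H\<close> and \<open>0\<close> on the others.\<close>

section \<open>Evaluation of multivariate polynomials\<close>

lemma lookup_sum_single:
  "(\<Sum>m\<in>Poly_Mapping.keys f. Poly_Mapping.single m (Poly_Mapping.lookup f m)) = (f :: 'a \<Rightarrow>\<^sub>0 'b::comm_monoid_add)"
  by (rule poly_mapping_eqI)
     (auto simp: lookup_sum lookup_single when_def sum.delta' in_keys_iff cong: sum.cong)

definition monom_val :: "(nat \<Rightarrow> 'b::comm_ring_1) \<Rightarrow> (nat \<Rightarrow>\<^sub>0 nat) \<Rightarrow> 'b" where
  "monom_val g m = (\<Prod>i\<in>Poly_Mapping.keys m. g i ^ Poly_Mapping.lookup m i)"

text \<open>Substitution with a separate map \<open>\<phi>\<close> on coefficients. It covers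
  \<open>msubst\<close> and \<open>meval\<close> alike, as well as change of the base field and
  reading a polynomial as univariate.\<close>

definition insertion :: "('a::comm_ring_1 \<Rightarrow> 'b::comm_ring_1) \<Rightarrow> (nat \<Rightarrow> 'b) \<Rightarrow> 'a mpoly \<Rightarrow> 'b" where
  "insertion \<phi> g f = (\<Sum>m\<in>Poly_Mapping.keys f. \<phi> (Poly_Mapping.lookup f m) * monom_val g m)"

lemma msubst_insertion: "msubst g f = insertion mconst g f"
  by (simp add: msubst_def insertion_def monom_val_def)

lemma meval_insertion: "meval \<iota> f u = insertion \<iota> (\<lambda>i. u $ i) f"
  by (simp add: meval_def insertion_def monom_val_def)

lemma monom_val_superset:
  assumes "finite S" "Poly_Mapping.keys m \<subseteq> S"
  shows "monom_val g m = (\<Prod>i\<in>S. g i ^ Poly_Mapping.lookup m i)"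
  unfolding monom_val_def
  by (rule prod.mono_neutral_left) (use assms in \<open>auto simp: in_keys_iff\<close>)

lemma monom_val_0 [simp]: "monom_val g 0 = 1"
  by (simp add: monom_val_def)

lemma monom_val_add: "monom_val g (m + m') = monom_val g m * monom_val g m'"
proof -
  let ?S = "Poly_Mapping.keys m \<union> Poly_Mapping.keys m'"
  have "monom_val g (m + m') = (\<Prod>i\<in>?S. g i ^ Poly_Mapping.lookup (m + m') i)"
    by (rule monom_val_superset) (auto dest: subsetD[OF keys_add])
  also have "\<dots> = (\<Prod>i\<in>?S. g i ^ Poly_Mapping.lookup m i) * (\<Prod>i\<in>?S. g i ^ Poly_Mapping.lookup m' i)"
    by (simp add: lookup_add power_add prod.distrib)
  also have "\<dots> = monom_val g m * monom_val g m'"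
    by (simp add: monom_val_superset[of ?S, symmetric])
  finally show ?thesis .
qed

lemma monom_val_single: "monom_val g (Poly_Mapping.single i k) = g i ^ k"
  by (cases "k = 0") (auto simp: monom_val_def)

lemma insertion_0: "insertion \<phi> g 0 = 0"
  by (simp add: insertion_def)

lemma insertion_cong:
  assumes "\<And>i. i \<in> mvars f \<Longrightarrow> g i = g' i"
  shows "insertion \<phi> g f = insertion \<phi> g' f"
proof -
  have "monom_val g m = monom_val g' m" if "m \<in> Poly_Mapping.keys f" for m
  proof -
    have "g i = g' i" if "i \<in> Poly_Mapping.keys m" for i
      by (rule assms) (use that \<open>m \<in> _\<close> in \<open>auto simp: mvars_def\<close>)
    then show ?thesis by (simp add: monom_val_def)
  qed
  then show ?thesis by (simp add: insertion_def)
qed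

context
  fixes \<phi> :: "'a::comm_ring_1 \<Rightarrow> 'b::comm_ring_1"
  assumes hom: "comm_ring_hom \<phi>"
begin

interpretation comm_ring_hom \<phi> by (rule hom)

lemma insertion_superset:
  assumes "finite S" "Poly_Mapping.keys f \<subseteq> S"
  shows "insertion \<phi> g f = (\<Sum>m\<in>S. \<phi> (Poly_Mapping.lookup f m) * monom_val g m)"
  unfolding insertion_def
  by (rule sum.mono_neutral_left) (use assms in \<open>auto simp: in_keys_iff\<close>)

lemma insertion_single: "insertion \<phi> g (Poly_Mapping.single m c) = \<phi> c * monom_val g m"
  by (cases "c = 0") (auto simp: insertion_def)

lemma insertion_mconst [simp]: "insertion \<phi> g (mconst c) = \<phi> c"
  by (simp add: mconst_def insertion_single)

lemma insertion_mvar [simp]: "insertion \<phi> g (mvar i) = g i"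
  by (simp add: mvar_def insertion_single monom_val_single)

lemma insertion_add: "insertion \<phi> g (f + h) = insertion \<phi> g f + insertion \<phi> g h"
proof -
  let ?S = "Poly_Mapping.keys f \<union> Poly_Mapping.keys h"
  have "insertion \<phi> g (f + h) = (\<Sum>m\<in>?S. \<phi> (Poly_Mapping.lookup (f + h) m) * monom_val g m)"
    by (rule insertion_superset) (auto dest: subsetD[OF keys_add])
  also have "\<dots> = insertion \<phi> g f + insertion \<phi> g h"
    by (simp add: lookup_add hom_add distrib_right sum.distrib insertion_superset[of ?S])
  finally show ?thesis .
qed

lemma insertion_sum: "insertion \<phi> g (sum f S) = (\<Sum>s\<in>S. insertion \<phi> g (f s))"
  by (induction S rule: infinite_finite_induct) (simp_all add: insertion_add, simp_all add: insertion_def)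

lemma insertion_mult: "insertion \<phi> g (f * h) = insertion \<phi> g f * insertion \<phi> g h"
proof -
  have "f * h = (\<Sum>m\<in>Poly_Mapping.keys f. \<Sum>m'\<in>Poly_Mapping.keys h.
      Poly_Mapping.single (m + m') (Poly_Mapping.lookup f m * Poly_Mapping.lookup h m'))"
    (is "_ = ?R")
    by (subst (1 2) lookup_sum_single[symmetric]) (simp add: sum_product mult_single)
  then have "insertion \<phi> g (f * h) = insertion \<phi> g ?R" by simp
  also have "\<dots> = insertion \<phi> g f * insertion \<phi> g h"
    by (simp add: insertion_sum insertion_single hom_mult monom_val_add)
       (simp add: insertion_def sum_product mult_ac)
  finally show ?thesis .
qed

lemma insertion_1: "insertion \<phi> g 1 = 1"
  by (simp add: insertion_def)

lemma insertion_hom: "comm_ring_hom (insertion \<phi> g)"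
  by unfold_locales (simp_all only: insertion_add insertion_mult insertion_0 insertion_1)

end

lemma hom_monom_val:
  assumes "comm_ring_hom \<psi>"
  shows "\<psi> (monom_val g m) = monom_val (\<lambda>i. \<psi> (g i)) m"
proof -
  interpret comm_ring_hom \<psi> by fact
  show ?thesis by (simp add: monom_val_def hom_prod hom_power)
qed

lemma hom_insertion:
  assumes "comm_ring_hom \<psi>"
  shows "\<psi> (insertion \<phi> g f) = insertion (\<lambda>c. \<psi> (\<phi> c)) (\<lambda>i. \<psi> (g i)) f"
proof -
  interpret comm_ring_hom \<psi> by fact
  show ?thesis by (simp add: insertion_def hom_sum hom_mult hom_monom_val[OF assms])
qed

lemma comm_ring_hom_id: "comm_ring_hom (\<lambda>x. x)"
  by unfold_locales auto

lemma comm_ring_hom_comp: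
  assumes "comm_ring_hom f" "comm_ring_hom g"
  shows "comm_ring_hom (\<lambda>x. f (g x))"
proof -
  interpret f: comm_ring_hom f by fact
  interpret g: comm_ring_hom g by fact
  show ?thesis by unfold_locales (simp_all add: g.hom_add f.hom_add g.hom_mult f.hom_mult)
qed

lemma mconst_hom: "comm_ring_hom mconst"
  by unfold_locales (auto simp: mconst_def single_add mult_single)

interpretation mconst: comm_ring_hom mconst by (rule mconst_hom)

lemma mvar_power: "mvar i ^ k = Poly_Mapping.single (Poly_Mapping.single i k) (1 :: 'k::comm_ring_1)"
  by (induction k) (auto simp: mvar_def mult_single single_add[symmetric])

lemma monom_val_mvar: "monom_val mvar m = Poly_Mapping.single m (1 :: 'k::comm_ring_1)"
proof -
  have *: "(\<Prod>i\<in>S. mvar i ^ Poly_Mapping.lookup m i)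
      = Poly_Mapping.single (\<Sum>i\<in>S. Poly_Mapping.single i (Poly_Mapping.lookup m i)) (1 :: 'k)"
    if "finite S" for S
    using that by (induction S rule: finite_induct) (auto simp: mvar_power mult_single)
  show ?thesis
    unfolding monom_val_def by (subst *) (auto simp: lookup_sum_single)
qed

lemma insertion_mconst_mvar: "insertion mconst mvar f = f"
  unfolding insertion_def
  by (subst (4) lookup_sum_single[symmetric])
     (auto simp: monom_val_mvar mconst_def mult_single intro!: sum.cong)

text \<open>The universal property of the polynomial ring: a homomorphism commutes with
  \<open>insertion\<close>, and \<open>insertion mconst mvar\<close> is the identity.\<close>

lemma hom_eq_insertion:
  assumes "comm_ring_hom \<psi>"
  shows "\<psi> f = insertion (\<lambda>c. \<psi> (mconst c)) (\<lambda>i. \<psi> (mvar i)) f"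
  by (subst insertion_mconst_mvar[symmetric, of f]) (rule hom_insertion[OF assms])

lemma hom_eqI:
  assumes "comm_ring_hom \<psi>" "comm_ring_hom \<psi>'"
    and "\<And>c. \<psi> (mconst c) = \<psi>' (mconst c)" "\<And>i. i \<in> mvars f \<Longrightarrow> \<psi> (mvar i) = \<psi>' (mvar i)"
  shows "\<psi> f = \<psi>' f"
proof -
  have "\<psi> f = insertion (\<lambda>c. \<psi> (mconst c)) (\<lambda>i. \<psi> (mvar i)) f"
    by (rule hom_eq_insertion[OF assms(1)])
  also have "\<dots> = insertion (\<lambda>c. \<psi>' (mconst c)) (\<lambda>i. \<psi>' (mvar i)) f"
    by (subst insertion_cong[where g' = "\<lambda>i. \<psi>' (mvar i)"])
       (simp_all add: assms(3,4))
  also have "\<dots> = \<psi>' f"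
    by (rule hom_eq_insertion[OF assms(2), symmetric])
  finally show ?thesis .
qed

lemma finite_mvars: "finite (mvars f)"
  by (simp add: mvars_def)

section \<open>Koszul complexes\<close>

text \<open>For finite \<open>J\<close> this is the ideal generated by the \<open>g j\<close>.
  Generators come as an indexed family so that initial segments \<open>{..<k}\<close> and omitted
  indices, on which regular sequences and relations depend, are easy to express.\<close>

definition lincombs :: "(nat \<Rightarrow> 'a::comm_ring_1) \<Rightarrow> nat set \<Rightarrow> 'a set" where
  "lincombs g J = {\<Sum>j\<in>J. r j * g j | r. True}"

lemma lincombsI: "x = (\<Sum>j\<in>J. r j * g j) \<Longrightarrow> x \<in> lincombs g J"
  by (auto simp: lincombs_def)

lemma lincombsE:
  assumes "x \<in> lincombs g J"
  obtains r where "x = (\<Sum>j\<in>J. r j * g j)"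
  using assms by (auto simp: lincombs_def)

lemma lincombs_0 [simp]: "0 \<in> lincombs g J"
  by (rule lincombsI[where r = "\<lambda>_. 0"]) simp

lemma lincombs_add:
  assumes "x \<in> lincombs g J" "y \<in> lincombs g J"
  shows "x + y \<in> lincombs g J"
proof -
  obtain r r' where "x = (\<Sum>j\<in>J. r j * g j)" "y = (\<Sum>j\<in>J. r' j * g j)"
    using assms by (elim lincombsE)
  then have "x + y = (\<Sum>j\<in>J. (r j + r' j) * g j)"
    by (simp add: distrib_right sum.distrib)
  then show ?thesis by (rule lincombsI)
qed

lemma lincombs_mult:
  assumes "x \<in> lincombs g J"
  shows "a * x \<in> lincombs g J"
proof -
  obtain r where "x = (\<Sum>j\<in>J. r j * g j)"
    using assms by (elim lincombsE)
  then have "a * x = (\<Sum>j\<in>J. (a * r j) * g j)"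
    by (simp add: sum_distrib_left mult.assoc)
  then show ?thesis by (rule lincombsI)
qed

lemma lincombs_uminus: "x \<in> lincombs g J \<Longrightarrow> - x \<in> lincombs g J"
  using lincombs_mult[of x g J "-1"] by simp

lemma lincombs_diff: "x \<in> lincombs g J \<Longrightarrow> y \<in> lincombs g J \<Longrightarrow> x - y \<in> lincombs g J"
  using lincombs_add[of x g J "- y"] lincombs_uminus[of y g J] by simp

lemma lincombs_sum: "(\<And>s. s \<in> S \<Longrightarrow> f s \<in> lincombs g J) \<Longrightarrow> sum f S \<in> lincombs g J"
  by (induction S rule: infinite_finite_induct) (auto intro: lincombs_add)

lemma lincombs_gen: "finite J \<Longrightarrow> j \<in> J \<Longrightarrow> g j \<in> lincombs g J"
  by (rule lincombsI[where r = "\<lambda>i. if i = j then 1 else 0"]) (auto simp: if_distrib[of "\<lambda>x. x * _"] cong: if_cong)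

lemma lincombs_subset:
  assumes "x \<in> lincombs g J" "\<And>j. j \<in> J \<Longrightarrow> g j \<in> lincombs h J'"
  shows "x \<in> lincombs h J'"
  using assms by (auto elim!: lincombsE intro!: lincombs_sum lincombs_mult)

lemma lincombs_mono: "finite J' \<Longrightarrow> J \<subseteq> J' \<Longrightarrow> lincombs g J \<subseteq> lincombs g J'"
  by (auto intro: lincombs_subset lincombs_gen)

lemma lincombs_cong: "(\<And>j. j \<in> J \<Longrightarrow> g j = h j) \<Longrightarrow> lincombs g J = lincombs h J"
  by (simp add: lincombs_def cong: sum.cong)

section \<open>The Koszul complex of a sequence of ring elements\<close>

definition koszul_sign :: "nat \<Rightarrow> nat set \<Rightarrow> 'a::comm_ring_1" where
  "koszul_sign j S = (-1) ^ card {i\<in>S. i < j}"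

text \<open>Elements of the exterior algebra on $e_0, e_1, \dots, e_{m-1}$ are given by their coefficients
  on the basis indexed by subsets of \<open>{..<m}\<close>.\<close>

definition koszul_d :: "nat \<Rightarrow> (nat \<Rightarrow> 'a::comm_ring_1) \<Rightarrow> (nat set \<Rightarrow> 'a) \<Rightarrow> nat set \<Rightarrow> 'a" where
  "koszul_d m g z S = (\<Sum>j\<in>{..<m} - S. koszul_sign j S * g j * z (insert j S))"

text \<open>Left exterior multiplication by the degree one element with coefficients
  \<open>c\<close>; the sign comes from sorting \<open>e_j\<close> into its place in the basis
  element of \<open>S\<close>.\<close>

definition koszul_wedge :: "(nat \<Rightarrow> 'a::comm_ring_1) \<Rightarrow> (nat set \<Rightarrow> 'a) \<Rightarrow> nat set \<Rightarrow> 'a" where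
  "koszul_wedge c z S = (\<Sum>j\<in>S. koszul_sign j (S - {j}) * c j * z (S - {j}))"

lemma koszul_sign_sq [simp]: "koszul_sign j S * koszul_sign j S = 1"
  by (simp add: koszul_sign_def power_add[symmetric])

lemma koszul_sign_insert:
  assumes "finite S" "i \<notin> S"
  shows "koszul_sign j (insert i S) = (if i < j then - koszul_sign j S else koszul_sign j S)"
proof (cases "i < j")
  case True
  then have "{k\<in>insert i S. k < j} = insert i {k\<in>S. k < j}" by auto
  with assms True show ?thesis by (simp add: koszul_sign_def)
next
  case False
  then have "{k\<in>insert i S. k < j} = {k\<in>S. k < j}" by auto
  with False show ?thesis by (simp add: koszul_sign_def)
qed

text \<open>Two basis elements anticommute: exactly one of the two orders of insertion meets the
  extra sign.\<close>

lemma koszul_sign_swap: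
  assumes "finite S" "i \<notin> S" "j \<notin> S" "i \<noteq> j"
  shows "koszul_sign i S * koszul_sign j (insert i S) = - (koszul_sign j S * koszul_sign i (insert j S))"
  using assms by (cases "i < j") (auto simp: koszul_sign_insert)

text \<open>The contributions of \<open>(i, j)\<close> and \<open>(j, i)\<close> cancel by
  \<open>koszul_sign_swap\<close>; hence the double sum is split into \<open>i < j\<close> and
  \<open>j < i\<close>, and one half is reindexed by \<open>prod.swap\<close>.\<close>

lemma koszul_d_d:
  assumes "finite S"
  shows "koszul_d m g (koszul_d m g z) S = (0 :: 'a::comm_ring_1)"
proof -
  let ?P = "{(i, j). i \<in> {..<m} - S \<and> j \<in> {..<m} - S \<and> i \<noteq> j}"
  let ?f = "\<lambda>(i, j). koszul_sign i S * g i * (koszul_sign j (insert i S) * g j * z (insert j (insert i S)))"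
  let ?L = "{(i, j)\<in>?P. i < j}" and ?R = "{(i, j)\<in>?P. j < i}"
  have fin: "finite ?P" by (rule finite_subset[of _ "{..<m} \<times> {..<m}"]) auto
  have "koszul_d m g (koszul_d m g z) S = (\<Sum>i\<in>{..<m} - S. \<Sum>j\<in>{..<m} - insert i S. ?f (i, j))"
    by (simp add: koszul_d_def sum_distrib_left)
  also have "\<dots> = sum ?f (Sigma ({..<m} - S) (\<lambda>i. {..<m} - insert i S))"
    by (subst sum.Sigma) auto
  also have "Sigma ({..<m} - S) (\<lambda>i. {..<m} - insert i S) = ?L \<union> ?R"
    by auto
  also have "sum ?f (?L \<union> ?R) = sum ?f ?L + sum ?f ?R"
    by (rule sum.union_disjoint) (auto intro: finite_subset[OF _ fin])
  also have "sum ?f ?R = (\<Sum>p\<in>?L. ?f (prod.swap p))"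
    by (rule sum.reindex_bij_witness[of _ prod.swap prod.swap]) auto
  also have "\<dots> = (\<Sum>p\<in>?L. - ?f p)"
  proof (rule sum.cong)
    fix p assume "p \<in> ?L"
    then obtain i j where p: "p = (i, j)" "i \<notin> S" "j \<notin> S" "i \<noteq> j" by auto
    have "?f (j, i) = (koszul_sign j S * koszul_sign i (insert j S)) * (g i * g j * z (insert j (insert i S)))"
      by (simp add: insert_commute mult_ac)
    also have "koszul_sign j S * koszul_sign i (insert j S) = - (koszul_sign i S * koszul_sign j (insert i S) :: 'a)"
      using koszul_sign_swap[OF assms p(2-4), where ?'a = 'a] by simp
    finally show "?f (prod.swap p) = - ?f p"
      using p by (simp add: mult_ac)
  qed simp
  finally show ?thesis by (simp add: sum_negf)
qed

text \<open>Multiplication by an element $\sum_j c_j g_j$ of the ideal is null-homotopic.\<close>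

lemma koszul_d_wedge:
  fixes z :: "nat set \<Rightarrow> 'a::comm_ring_1"
  assumes "S \<subseteq> {..<m}"
  shows "koszul_d m g (koszul_wedge c z) S + koszul_wedge c (koszul_d m g z) S = (\<Sum>j<m. c j * g j) * z S"
proof -
  have fin: "finite S" using assms finite_subset by blast
  define X :: "nat \<Rightarrow> nat \<Rightarrow> 'a" where
    "X i j = koszul_sign j S * g j * (koszul_sign i (insert j S - {i}) * c i * z (insert j S - {i}))" for i j
  have "koszul_d m g (koszul_wedge c z) S = (\<Sum>j\<in>{..<m} - S. \<Sum>i\<in>insert j S. X i j)"
    by (simp add: koszul_d_def koszul_wedge_def sum_distrib_left X_def)
  \<comment> \<open>The index just inserted gives the diagonal terms. Together with the diagonal of
    the other composite they make up the right-hand side, while the remaining terms cancel in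
    pairs.\<close>
  also have "\<dots> = (\<Sum>j\<in>{..<m} - S. X j j + (\<Sum>i\<in>S. X i j))"
    by (rule sum.cong) (use fin in auto)
  also have "\<dots> = (\<Sum>j\<in>{..<m} - S. c j * g j * z S) + (\<Sum>j\<in>{..<m} - S. \<Sum>i\<in>S. X i j)"
  proof -
    have "X j j = c j * g j * z S" if "j \<notin> S" for j
    proof -
      have "X j j = (koszul_sign j S * koszul_sign j S) * (c j * g j * z S)"
        using that by (simp add: X_def mult_ac)
      then show ?thesis by simp
    qed
    then show ?thesis by (simp add: sum.distrib)
  qed
  finally have 1: "koszul_d m g (koszul_wedge c z) S
    = (\<Sum>j\<in>{..<m} - S. c j * g j * z S) + (\<Sum>j\<in>{..<m} - S. \<Sum>i\<in>S. X i j)" .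
  define Y :: "nat \<Rightarrow> nat \<Rightarrow> 'a" where
    "Y i j = koszul_sign i (S - {i}) * c i * (koszul_sign j (S - {i}) * g j * z (insert j (S - {i})))" for i j
  have "koszul_wedge c (koszul_d m g z) S = (\<Sum>i\<in>S. \<Sum>j\<in>{..<m} - (S - {i}). Y i j)"
    by (simp add: koszul_d_def koszul_wedge_def sum_distrib_left Y_def)
  also have "\<dots> = (\<Sum>i\<in>S. Y i i + (\<Sum>j\<in>{..<m} - S. Y i j))"
  proof (rule sum.cong)
    fix i assume "i \<in> S"
    then have "{..<m} - (S - {i}) = insert i ({..<m} - S)" using assms by auto
    then show "(\<Sum>j\<in>{..<m} - (S - {i}). Y i j) = Y i i + (\<Sum>j\<in>{..<m} - S. Y i j)"
      using \<open>i \<in> S\<close> by simp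
  qed simp
  also have "\<dots> = (\<Sum>i\<in>S. c i * g i * z S) + (\<Sum>i\<in>S. \<Sum>j\<in>{..<m} - S. Y i j)"
  proof -
    have "Y i i = c i * g i * z S" if "i \<in> S" for i
    proof -
      have "Y i i = (koszul_sign i (S - {i}) * koszul_sign i (S - {i})) * (c i * g i * z S)"
        using that by (simp only: Y_def insert_Diff mult_ac)
      then show ?thesis by simp
    qed
    then show ?thesis by (simp add: sum.distrib)
  qed
  also have "(\<Sum>i\<in>S. \<Sum>j\<in>{..<m} - S. Y i j) = (\<Sum>j\<in>{..<m} - S. \<Sum>i\<in>S. - X i j)"
  proof (subst sum.swap, intro sum.cong refl)
    fix i j assume ij: "i \<in> S" "j \<in> {..<m} - S"
    define T where "T = S - {i}"
    have S: "S = insert i T" "i \<notin> T" "j \<notin> T" "i \<noteq> j" "finite T"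
      using ij fin by (auto simp: T_def)
    have J: "insert j S - {i} = insert j T" using S by auto
    have "Y i j = (koszul_sign i T * koszul_sign j T) * (c i * g j * z (insert j T))"
      by (simp add: Y_def T_def mult_ac)
    moreover have "X i j = (koszul_sign j S * koszul_sign i (insert j T)) * (c i * g j * z (insert j T))"
      by (simp add: X_def J mult_ac)
    moreover have "koszul_sign j S * koszul_sign i (insert j T) = - (koszul_sign i T * koszul_sign j T :: 'a)"
      using S(2-5) unfolding S(1) by (cases "i < j") (auto simp: koszul_sign_insert)
    ultimately show "Y i j = - X i j" by simp
  qed
  finally have 2: "koszul_wedge c (koszul_d m g z) S
    = (\<Sum>i\<in>S. c i * g i * z S) - (\<Sum>j\<in>{..<m} - S. \<Sum>i\<in>S. X i j)"
    by (simp add: sum_negf)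
  have "(\<Sum>j<m. c j * g j) * z S = (\<Sum>j<m. c j * g j * z S)"
    by (simp add: sum_distrib_right)
  also have "\<dots> = (\<Sum>j\<in>{..<m} - S. c j * g j * z S) + (\<Sum>i\<in>S. c i * g i * z S)"
    by (rule sum.subset_diff[OF assms]) simp
  finally show ?thesis using 1 2 by simp
qed

lemma koszul_d_diff: "koszul_d m g (\<lambda>S. x S - y S) S = koszul_d m g x S - koszul_d m g y S"
  by (simp add: koszul_d_def right_diff_distrib sum_subtractf)

lemma koszul_d_in_lincombs:
  assumes "\<And>T. T \<subseteq> {..<m} \<Longrightarrow> card T = Suc i \<Longrightarrow> x T \<in> lincombs h J"
    and "S \<subseteq> {..<m}" "card S = i"
  shows "koszul_d m g x S \<in> lincombs h J"
proof -
  have "finite S" using assms(2) finite_subset by blast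
  then show ?thesis
    unfolding koszul_d_def using assms(2,3)
    by (intro lincombs_sum lincombs_mult assms(1)) auto
qed

lemma koszul_wedge_in_lincombs:
  assumes "\<And>T. T \<subseteq> {..<m} \<Longrightarrow> card T = i - 1 \<Longrightarrow> x T \<in> lincombs h J"
    and "S \<subseteq> {..<m}" "card S = i"
  shows "koszul_wedge c x S \<in> lincombs h J"
proof -
  have "finite S" using assms(2) finite_subset by blast
  then show ?thesis
    unfolding koszul_wedge_def using assms(2,3)
    by (intro lincombs_sum lincombs_mult assms(1)) auto
qed

lemma lincombs_Suc:
  assumes "x \<in> lincombs h {..<Suc k}"
  shows "\<exists>a. x - a * h k \<in> lincombs h {..<k}"
proof -
  obtain r where "x = (\<Sum>j<Suc k. r j * h j)"
    using assms by (elim lincombsE)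
  then have "x - r k * h k = (\<Sum>j<k. r j * h j)" by simp
  then show ?thesis by (blast intro: lincombsI)
qed

text \<open>The Koszul homology $H_i(g; R/(h_0, \dots, h_{k-1}))$ vanishes for $i > k$, by descending induction
  on $i$: $h_k$ lies in the ideal of the $g_j$, so it annihilates Koszul homology, and
  multiplication by $h_k$ makes $H_i$ modulo $k$ elements a quotient of $H_{i+1}$ modulo $k+1$ elements.\<close>

lemma koszul_homology_vanishes:
  fixes g h :: "nat \<Rightarrow> 'a::comm_ring_1"
  assumes gen: "\<And>k. k < m \<Longrightarrow> h k \<in> lincombs g {..<m}"
    and reg: "\<And>k p. k < m \<Longrightarrow> h k * p \<in> lincombs h {..<k} \<Longrightarrow> p \<in> lincombs h {..<k}"
    and "k < i" "i \<le> Suc m"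
    and "\<And>S. S \<subseteq> {..<m} \<Longrightarrow> card S = i - 1 \<Longrightarrow> koszul_d m g z S \<in> lincombs h {..<k}"
  shows "\<exists>w. \<forall>S\<subseteq>{..<m}. card S = i \<longrightarrow> z S - koszul_d m g w S \<in> lincombs h {..<k}"
  using assms(4,3,5)
proof (induction i arbitrary: k z rule: inc_induct)
  case base
  have "card S \<noteq> Suc m" if "S \<subseteq> {..<m}" for S
    using card_mono[OF _ that] by auto
  then show ?case by blast
next
  case (step i)
  then have k: "k < m" by simp
  obtain c where c: "h k = (\<Sum>j<m. c j * g j)"
    using gen[OF k] by (elim lincombsE)
  define w where "w = koszul_wedge c z"
  have sub: "lincombs h {..<k} \<subseteq> lincombs h {..<Suc k}"
    by (rule lincombs_mono) auto
  \<comment> \<open>The homotopy formula for the coefficients of \<open>h k\<close>: the error term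
    is \<open>c\<close> wedged with \<open>koszul_d m g z\<close>, which vanishes modulo the first
    \<open>k\<close> elements.\<close>
  have dw: "h k * z S - koszul_d m g w S \<in> lincombs h {..<k}" if S: "S \<subseteq> {..<m}" "card S = i" for S
  proof -
    have "koszul_wedge c (koszul_d m g z) S \<in> lincombs h {..<k}"
      by (rule koszul_wedge_in_lincombs[OF step.prems(2) S])
    moreover have "h k * z S - koszul_d m g w S = koszul_wedge c (koszul_d m g z) S"
      using koszul_d_wedge[OF S(1), of g c z] by (simp add: c w_def algebra_simps)
    ultimately show ?thesis by simp
  qed
  \<comment> \<open>Since \<open>h k\<close> now counts as zero, \<open>w\<close> is a cycle modulo
    the first \<open>k + 1\<close> elements, one degree higher, and the induction hypothesis makes
    it a boundary there.\<close>
  have "koszul_d m g w S \<in> lincombs h {..<Suc k}" if S: "S \<subseteq> {..<m}" "card S = i" for S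
  proof -
    have "z S * h k \<in> lincombs h {..<Suc k}"
      by (intro lincombs_mult lincombs_gen) auto
    from lincombs_diff[OF this, of "h k * z S - koszul_d m g w S"] show ?thesis
      using dw[OF S] sub by (auto simp: mult.commute)
  qed
  then obtain v where v: "\<And>S. S \<subseteq> {..<m} \<Longrightarrow> card S = Suc i \<Longrightarrow>
      w S - koszul_d m g v S \<in> lincombs h {..<Suc k}"
    using step.IH[of "Suc k" w] step.prems by auto
  \<comment> \<open>Lifted back to the first \<open>k\<close> elements, \<open>w\<close> is a
    boundary plus \<open>a S * h k\<close>; the chain \<open>a\<close> turns out to bound
    \<open>z\<close>.\<close>
  define a where "a S = (SOME a. w S - koszul_d m g v S - a * h k \<in> lincombs h {..<k})" for S
  have a: "w S - koszul_d m g v S - a S * h k \<in> lincombs h {..<k}" if "S \<subseteq> {..<m}" "card S = Suc i" for S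
    unfolding a_def by (rule someI_ex) (rule lincombs_Suc[OF v[OF that]])
  \<comment> \<open>Applying the differential once more removes \<open>koszul_d m g v\<close>, so
    \<open>h k\<close> times this difference vanishes modulo the first \<open>k\<close> elements,
    and regularity cancels \<open>h k\<close>.\<close>
  have "z S - koszul_d m g a S \<in> lincombs h {..<k}" if S: "S \<subseteq> {..<m}" "card S = i" for S
  proof (rule reg[OF k])
    have "finite S" using S(1) finite_subset by blast
    have "koszul_d m g (\<lambda>S. w S - koszul_d m g v S - a S * h k) S \<in> lincombs h {..<k}"
      by (rule koszul_d_in_lincombs[OF a S])
    also have "koszul_d m g (\<lambda>S. w S - koszul_d m g v S - a S * h k) S
        = koszul_d m g w S - h k * koszul_d m g a S"
      by (simp add: koszul_d_diff koszul_d_d[OF \<open>finite S\<close>])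
         (simp add: koszul_d_def sum_distrib_left mult_ac)
    finally have "(h k * z S - koszul_d m g w S) + (koszul_d m g w S - h k * koszul_d m g a S)
        \<in> lincombs h {..<k}"
      by (intro lincombs_add dw S)
    then show "h k * (z S - koszul_d m g a S) \<in> lincombs h {..<k}"
      by (simp add: right_diff_distrib)
  qed
  then show ?case by blast
qed

text \<open>The case of degree one with no \<open>h\<close> divided out: a relation is a cycle,
  hence a boundary, and the coefficient of a boundary at \<open>i\<close> involves only the
  \<open>g j\<close> with \<open>j \<noteq> i\<close>. The regular sequence \<open>h\<close> has the
  same length as \<open>g\<close>, which makes every positive degree exact.\<close>

theorem relation_coefficient_in_ideal:
  fixes g h :: "nat \<Rightarrow> 'a::comm_ring_1"
  assumes gen: "\<And>k. k < m \<Longrightarrow> h k \<in> lincombs g {..<m}"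
    and reg: "\<And>k p. k < m \<Longrightarrow> h k * p \<in> lincombs h {..<k} \<Longrightarrow> p \<in> lincombs h {..<k}"
    and rel: "(\<Sum>j<m. c j * g j) = 0" and "i < m"
  shows "c i \<in> lincombs g ({..<m} - {i})"
proof -
  \<comment> \<open>In degree one a chain is given by its values at singletons, where
    \<open>the_elem\<close> returns the index.\<close>
  define z where "z S = c (the_elem S)" for S
  have "koszul_d m g z {} = 0"
    using rel by (simp add: koszul_d_def koszul_sign_def z_def mult.commute)
  then have "koszul_d m g z S \<in> lincombs h {..<0}" if "S \<subseteq> {..<m}" "card S = 1 - 1" for S
    using that finite_subset[of S "{..<m}"] by auto
  from koszul_homology_vanishes[OF gen reg _ _ this, of 1] obtain w where
    w: "\<And>S. S \<subseteq> {..<m} \<Longrightarrow> card S = 1 \<Longrightarrow> z S - koszul_d m g w S \<in> lincombs h {..<0}"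
    by auto
  have "c i - koszul_d m g w {i} = 0"
    using w[of "{i}"] \<open>i < m\<close> by (auto simp: z_def elim: lincombsE)
  then have "c i = (\<Sum>j\<in>{..<m} - {i}. (koszul_sign j {i} * w {j, i}) * g j)"
    by (simp add: koszul_d_def mult_ac)
  then show ?thesis by (rule lincombsI)
qed

section \<open>The Nullstellensatz\<close>

definition ring_ideal :: "'a::comm_ring_1 set \<Rightarrow> bool" where
  "ring_ideal I \<longleftrightarrow> 0 \<in> I \<and> (\<forall>x\<in>I. \<forall>y\<in>I. x + y \<in> I) \<and> (\<forall>a. \<forall>x\<in>I. a * x \<in> I)"

definition ring_prime :: "'a::comm_ring_1 set \<Rightarrow> bool" where
  "ring_prime I \<longleftrightarrow> ring_ideal I \<and> 1 \<notin> I \<and> (\<forall>x y. x * y \<in> I \<longrightarrow> x \<in> I \<or> y \<in> I)"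

lemma ring_ideal_0: "ring_ideal I \<Longrightarrow> 0 \<in> I"
  and ring_ideal_add: "ring_ideal I \<Longrightarrow> x \<in> I \<Longrightarrow> y \<in> I \<Longrightarrow> x + y \<in> I"
  and ring_ideal_mult: "ring_ideal I \<Longrightarrow> x \<in> I \<Longrightarrow> a * x \<in> I"
  by (auto simp: ring_ideal_def)

lemma ring_ideal_mult2: "ring_ideal I \<Longrightarrow> x \<in> I \<Longrightarrow> x * a \<in> I"
  by (simp add: mult.commute ring_ideal_mult)

lemma ring_ideal_uminus: "ring_ideal I \<Longrightarrow> x \<in> I \<Longrightarrow> - x \<in> I"
  using ring_ideal_mult[of I x "-1"] by simp

lemma ring_ideal_diff: "ring_ideal I \<Longrightarrow> x \<in> I \<Longrightarrow> y \<in> I \<Longrightarrow> x - y \<in> I"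
  using ring_ideal_add[of I x "- y"] ring_ideal_uminus[of I y] by simp

lemma ring_ideal_sum: "ring_ideal I \<Longrightarrow> (\<And>s. s \<in> S \<Longrightarrow> f s \<in> I) \<Longrightarrow> sum f S \<in> I"
  by (induction S rule: infinite_finite_induct) (auto intro: ring_ideal_0 ring_ideal_add)

lemma ring_primeD:
  assumes "ring_prime I"
  shows "ring_ideal I" "1 \<notin> I" "x * y \<in> I \<Longrightarrow> x \<in> I \<or> y \<in> I"
  using assms by (auto simp: ring_prime_def)

lemma ring_prime_power: "ring_prime I \<Longrightarrow> x ^ k \<in> I \<Longrightarrow> x \<in> I"
  by (induction k) (auto dest: ring_primeD)

lemma ring_ideal_lincombs: "ring_ideal (lincombs g J)"
  by (auto simp: ring_ideal_def lincombs_add lincombs_mult)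

lemma ring_ideal_vimage:
  assumes "comm_ring_hom \<psi>" "ring_ideal I"
  shows "ring_ideal {x. \<psi> x \<in> I}"
proof -
  interpret comm_ring_hom \<psi> by fact
  show ?thesis using assms(2) by (simp add: ring_ideal_def hom_add hom_mult)
qed

lemma ring_prime_vimage:
  assumes "comm_ring_hom \<psi>" "ring_prime I"
  shows "ring_prime {x. \<psi> x \<in> I}"
proof -
  interpret comm_ring_hom \<psi> by fact
  show ?thesis
    using assms(2) ring_ideal_vimage[OF assms(1)] by (simp add: ring_prime_def hom_mult)
qed

lemma ring_ideal_extend:
  assumes "ring_ideal I"
  shows "ring_ideal {p + q * f | p q. p \<in> I}"
proof -
  have "\<exists>p'' q''. p + q * f + (p' + q' * f) = p'' + q'' * f \<and> p'' \<in> I" if "p \<in> I" "p' \<in> I" for p p' q q'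
    by (rule exI[of _ "p + p'"], rule exI[of _ "q + q'"])
       (use that assms in \<open>auto simp: algebra_simps intro: ring_ideal_add\<close>)
  moreover have "\<exists>p' q'. a * (p + q * f) = p' + q' * f \<and> p' \<in> I" if "p \<in> I" for a p q
    by (rule exI[of _ "a * p"], rule exI[of _ "a * q"])
       (use that assms in \<open>auto simp: algebra_simps intro: ring_ideal_mult\<close>)
  moreover have "\<exists>p q. 0 = p + q * f \<and> p \<in> I"
    by (rule exI[of _ 0], rule exI[of _ 0]) (use assms in \<open>auto intro: ring_ideal_0\<close>)
  ultimately show ?thesis unfolding ring_ideal_def by blast
qed

lemma ideal_subset_extend:
  fixes I :: "'a::comm_ring_1 set"
  shows "I \<subseteq> {p + q * f | p q. p \<in> I}"
proof
  fix p assume "p \<in> I"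
  then show "p \<in> {p + q * f | p q. p \<in> I}"
    unfolding mem_Collect_eq by - (rule exI[of _ p], rule exI[of _ 0], simp)
qed

lemma generator_in_extend: "ring_ideal I \<Longrightarrow> f \<in> {p + q * f | p q. p \<in> I}"
  unfolding mem_Collect_eq by (rule exI[of _ 0], rule exI[of _ 1]) (simp add: ring_ideal_0)

text \<open>An ideal that is maximal among those containing \<open>I\<close> and no power of
  \<open>f\<close> is prime; Zorn's lemma provides it.\<close>

lemma prime_avoiding_powers:
  assumes I: "ring_ideal I" and f: "\<And>N. f ^ N \<notin> I"
  obtains M where "ring_prime M" "I \<subseteq> M" "f \<notin> M"
proof -
  define A where "A = {J. ring_ideal J \<and> I \<subseteq> J \<and> (\<forall>N. f ^ N \<notin> J)}"
  have "\<exists>M\<in>A. \<forall>X\<in>A. M \<subseteq> X \<longrightarrow> X = M"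
  proof (rule subset_Zorn_nonempty)
    show "A \<noteq> {}" using I f by (auto simp: A_def)
    fix C assume C: "C \<noteq> {}" "subset.chain A C"
    then have CA: "\<And>J. J \<in> C \<Longrightarrow> ring_ideal J \<and> I \<subseteq> J \<and> (\<forall>N. f ^ N \<notin> J)"
      by (auto simp: subset_chain_def A_def)
    have "x + y \<in> \<Union>C" if xy: "x \<in> J" "J \<in> C" "y \<in> J'" "J' \<in> C" for x y J J'
    proof -
      have "J \<subseteq> J' \<or> J' \<subseteq> J" using C xy by (auto simp: subset_chain_def)
      then show ?thesis using xy CA by (blast intro: ring_ideal_add)
    qed
    moreover have "a * x \<in> \<Union>C" if "x \<in> J" "J \<in> C" for a x J
      using that CA ring_ideal_mult by blast
    moreover obtain J where J: "J \<in> C" using C(1) by blast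
    moreover have "0 \<in> J" using CA[OF J] ring_ideal_0 by blast
    ultimately have "ring_ideal (\<Union>C)"
      unfolding ring_ideal_def by (intro conjI ballI allI) blast+
    moreover have "I \<subseteq> \<Union>C" using CA[OF J] J by blast
    moreover have "f ^ N \<notin> \<Union>C" for N using CA by blast
    ultimately show "\<Union>C \<in> A" by (simp add: A_def)
  qed
  then obtain M where MA: "M \<in> A" and maxA: "\<And>X. X \<in> A \<Longrightarrow> M \<subseteq> X \<Longrightarrow> X = M" by metis
  have M: "ring_ideal M" "I \<subseteq> M" "\<And>N. f ^ N \<notin> M" using MA by (auto simp: A_def)
  have max: "X = M" if "ring_ideal X" "I \<subseteq> X" "M \<subseteq> X" "\<forall>N. f ^ N \<notin> X" for X
    using that by (intro maxA) (auto simp: A_def)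
  have ext: "\<exists>N p q. p \<in> M \<and> f ^ N = p + q * x" if "x \<notin> M" for x
  proof (rule ccontr)
    assume c: "\<not> ?thesis"
    have "M \<subseteq> {p + q * x | p q. p \<in> M}" by (rule ideal_subset_extend)
    moreover have "\<forall>N. f ^ N \<notin> {p + q * x | p q. p \<in> M}"
    proof (intro allI notI)
      fix N assume "f ^ N \<in> {p + q * x | p q. p \<in> M}"
      then obtain p q where "f ^ N = p + q * x" "p \<in> M" unfolding mem_Collect_eq by (elim exE conjE)
      with c show False by metis
    qed
    ultimately have "{p + q * x | p q. p \<in> M} = M"
      using M(2) by (intro max[OF ring_ideal_extend[OF M(1)]]) (rule subset_trans)
    then show False using generator_in_extend[OF M(1), of x] that by simp
  qed
  have "x \<in> M \<or> y \<in> M" if xy: "x * y \<in> M" for x y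
  proof (rule ccontr)
    assume "\<not> ?thesis"
    then have "x \<notin> M" "y \<notin> M" by auto
    obtain N p q where 1: "p \<in> M" "f ^ N = p + q * x" using ext[OF \<open>x \<notin> M\<close>] by blast
    obtain N' p' q' where 2: "p' \<in> M" "f ^ N' = p' + q' * y" using ext[OF \<open>y \<notin> M\<close>] by blast
    note * = 1 2
    \<comment> \<open>Powers of \<open>f\<close> lie in \<open>M + (x)\<close> and in
      \<open>M + (y)\<close>; their product lies in \<open>M + (x * y)\<close>, which is
      \<open>M\<close>.\<close>
    have "f ^ (N + N') = (p' + q' * y) * p + (q * x) * p' + (q * q') * (x * y)"
      by (simp add: power_add *(2,4)) (simp add: algebra_simps)
    also have "\<dots> \<in> M" by (rule ring_ideal_add[OF M(1)], rule ring_ideal_add[OF M(1)])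
      (auto intro: ring_ideal_mult[OF M(1)] * xy)
    finally show False using M(3) by blast
  qed
  moreover have "1 \<notin> M" "f \<notin> M" using M(3)[of 0] M(3)[of 1] by auto
  ultimately show ?thesis using M(1,2) by (intro that[of M]) (simp_all add: ring_prime_def)
qed

section \<open>Extending points from a ring to its univariate polynomial ring\<close>

definition alg_closed :: "'a::field itself \<Rightarrow> bool" where
  "alg_closed _ \<longleftrightarrow> (\<forall>p::'a poly. degree p > 0 \<longrightarrow> (\<exists>x. poly p x = 0))"

text \<open>Over a finite field the product of all \<open>X - a\<close>, plus one, is a nonconstant
  polynomial without roots.\<close>

lemma alg_closed_infinite:
  assumes "alg_closed TYPE('a::field)"
  shows "infinite (UNIV :: 'a set)"
proof
  assume fin: "finite (UNIV :: 'a set)"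
  define p :: "'a poly" where "p = (\<Prod>a\<in>UNIV. [:-a, 1:]) + 1"
  have "degree (\<Prod>a\<in>(UNIV :: 'a set). [:-a, 1:]) = card (UNIV :: 'a set)"
    by (subst degree_prod_eq_sum_degree) auto
  moreover have "card (UNIV :: 'a set) > 0" using fin by (simp add: card_gt_0_iff)
  ultimately have "degree p > 0" by (simp add: p_def degree_add_eq_left)
  then obtain x where "poly p x = 0" using assms by (auto simp: alg_closed_def)
  moreover have "poly (\<Prod>a\<in>(UNIV :: 'a set). [:-a, 1:]) x = 0"
    using fin by (auto simp: poly_prod intro!: prod_zero)
  ultimately show False by (simp add: p_def)
qed

lemma infinite_field_nonroot:
  fixes p :: "'a::idom poly"
  assumes "infinite (UNIV :: 'a set)" "p \<noteq> 0"
  obtains x where "poly p x \<noteq> 0"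
  using ex_new_if_finite[OF assms(1) poly_roots_finite[OF assms(2)]] by auto

lemma poly_map_poly_hom:
  assumes "comm_ring_hom \<phi>"
  shows "comm_ring_hom (\<lambda>p. poly (map_poly \<phi> p) c)"
proof -
  interpret comm_ring_hom \<phi> by fact
  interpret m: map_poly_comm_ring_hom \<phi> ..
  show ?thesis by unfold_locales (auto simp: m.hom_add m.hom_mult)
qed

lemma map_poly_const:
  assumes "comm_ring_hom \<phi>"
  shows "map_poly \<phi> [:x:] = [:\<phi> x:]"
proof -
  interpret comm_ring_hom \<phi> by fact
  show ?thesis by (rule poly_eqI) (simp add: coeff_pCons split: nat.split)
qed

lemma poly_in_ideal_of_coeffs:
  assumes "ring_ideal I" "\<And>k. [:coeff p k:] \<in> I"
  shows "p \<in> I"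
proof -
  have "p = (\<Sum>k\<le>degree p. [:coeff p k:] * monom 1 k)"
    by (subst poly_as_sum_of_monoms[symmetric]) (simp add: smult_monom)
  also have "\<dots> \<in> I" using assms by (intro ring_ideal_sum ring_ideal_mult2) auto
  finally show ?thesis .
qed

text \<open>Among the elements of \<open>J\<close> with some coefficient outside \<open>I0\<close>,
  one of least degree is taken. If its leading coefficient were in \<open>I0\<close>, subtracting
  the leading term would stay in \<open>J\<close>, keep the outside coefficient and lower the
  degree.\<close>

lemma minimal_degree_element:
  fixes J :: "'a::comm_ring_1 poly set"
  assumes J: "ring_ideal J" and I0: "ring_ideal I0" and sub: "\<And>c. c \<in> I0 \<Longrightarrow> [:c:] \<in> J"
    and p: "p \<in> J" "coeff p k \<notin> I0"
  obtains g where "g \<in> J" "lead_coeff g \<notin> I0" "degree g \<le> degree p"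
    "\<And>q k. q \<in> J \<Longrightarrow> degree q < degree g \<Longrightarrow> coeff q k \<in> I0"
proof -
  let ?P = "\<lambda>g. g \<in> J \<and> (\<exists>k. coeff g k \<notin> I0)"
  obtain g where g: "?P g" and min: "\<And>q. ?P q \<Longrightarrow> degree g \<le> degree q"
    using ex_has_least_nat[of ?P p degree] p by blast
  have "lead_coeff g \<notin> I0"
  proof
    assume lc: "lead_coeff g \<in> I0"
    define q where "q = g - monom (lead_coeff g) (degree g)"
    have "[:lead_coeff g:] * monom 1 (degree g) \<in> J"
      by (rule ring_ideal_mult2[OF J sub[OF lc]])
    then have "monom (lead_coeff g) (degree g) \<in> J" by (simp add: smult_monom)
    with g have "q \<in> J" unfolding q_def by (intro ring_ideal_diff[OF J]) auto
    obtain k where k: "coeff g k \<notin> I0" using g by blast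
    with lc have "k \<noteq> degree g" by auto
    with k have qk: "coeff q k \<notin> I0" by (simp add: q_def)
    with \<open>q \<in> J\<close> have "degree g \<le> degree q" by (intro min) blast
    moreover have "degree q \<le> degree g" unfolding q_def
      by (intro degree_diff_le degree_monom_le) auto
    ultimately have "lead_coeff q = coeff q (degree g)" by simp
    also have "\<dots> = 0" by (simp add: q_def)
    finally have "q = 0" by simp
    with qk I0 show False by (auto intro: ring_ideal_0)
  qed
  moreover have "coeff q k \<in> I0" if "q \<in> J" "degree q < degree g" for q k
    using min[of q] that by force
  ultimately show ?thesis using that[of g] g min[of p] p by blast
qed

lemma pseudo_division:
  fixes f g :: "'a::comm_ring_1 poly"
  assumes "g \<noteq> 0"
  obtains k q r where "smult (lead_coeff g ^ k) f = g * q + r" "r = 0 \<or> degree r < degree g"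
  using pseudo_divmod[OF assms, of f "fst (pseudo_divmod f g)" "snd (pseudo_divmod f g)"] by auto

text \<open>The existence of the bound \<open>d\<close> says that the projection $\operatorname{Spec} R[T] \to \operatorname{Spec} R$ maps
  the locus $V(I) \cap D(f)$ onto a set containing an open dense subset of $V(I \cap R)$.\<close>

lemma extend_points_to_poly:
  fixes I :: "'a::idom poly set"
  assumes I: "ring_prime I" and f: "f \<notin> I"
  shows "\<exists>d. [:d:] \<notin> I \<and> (\<forall>\<phi>::'a \<Rightarrow> 'b::field. alg_closed TYPE('b) \<longrightarrow> comm_ring_hom \<phi> \<longrightarrow>
     (\<forall>x. [:x:] \<in> I \<longrightarrow> \<phi> x = 0) \<longrightarrow> \<phi> d \<noteq> 0 \<longrightarrow>
     (\<exists>c. (\<forall>p\<in>I. poly (map_poly \<phi> p) c = 0) \<and> poly (map_poly \<phi> f) c \<noteq> 0))"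
proof -
  define I0 where "I0 = {x. [:x:] \<in> I}"
  have "comm_ring_hom (\<lambda>x::'a. [:x:])" by unfold_locales auto
  from ring_prime_vimage[OF this I] have I0: "ring_prime I0" by (simp add: I0_def)
  note id = ring_primeD(1)[OF I] and id0 = ring_primeD(1)[OF I0]
  have I0I: "p \<in> I" if "\<And>k. coeff p k \<in> I0" for p
    by (rule poly_in_ideal_of_coeffs[OF id]) (use that in \<open>simp add: I0_def\<close>)
  have map0: "map_poly \<phi> p = 0" if "\<And>x. x \<in> I0 \<Longrightarrow> \<phi> x = 0" "\<And>k. coeff p k \<in> I0" "comm_ring_hom \<phi>"
    for \<phi> :: "'a \<Rightarrow> 'b" and p
  proof -
    interpret comm_ring_hom \<phi> by fact
    show ?thesis using that by (intro poly_eqI) simp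
  qed
  show ?thesis
  proof (cases "\<forall>p\<in>I. \<forall>k. coeff p k \<in> I0")
    case True
    \<comment> \<open>Here \<open>I\<close> is the extension of its contraction \<open>I0\<close>,
      so the fibre over a point is the whole line; a coefficient of \<open>f\<close> outside
      \<open>I0\<close> serves as \<open>d\<close>.\<close>
    obtain k where k: "coeff f k \<notin> I0" using I0I[of f] f by blast
    have "\<exists>c. (\<forall>p\<in>I. poly (map_poly \<phi> p) c = 0) \<and> poly (map_poly \<phi> f) c \<noteq> 0"
      if \<phi>: "alg_closed TYPE('b)" "comm_ring_hom \<phi>" "\<forall>x. [:x:] \<in> I \<longrightarrow> \<phi> x = 0" "\<phi> (coeff f k) \<noteq> 0"
      for \<phi> :: "'a \<Rightarrow> 'b"
    proof -
      interpret comm_ring_hom \<phi> by fact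
      have "coeff (map_poly \<phi> f) k \<noteq> 0" using \<phi>(4) by simp
      then have "map_poly \<phi> f \<noteq> 0" by (metis coeff_0)
      then obtain c where "poly (map_poly \<phi> f) c \<noteq> 0"
        using infinite_field_nonroot[OF alg_closed_infinite[OF \<phi>(1)]] by blast
      moreover have "map_poly \<phi> p = 0" if "p \<in> I" for p
        using \<phi>(3) True that by (intro map0 \<phi>(2)) (auto simp: I0_def)
      ultimately show ?thesis by auto
    qed
    with k show ?thesis by (auto simp: I0_def)
  next
    case False
    then obtain p0 k0 where "p0 \<in> I" "coeff p0 k0 \<notin> I0" by blast
    moreover have "[:x:] \<in> I" if "x \<in> I0" for x using that by (simp add: I0_def)
    \<comment> \<open>Over the fraction field of the coefficient ring modulo \<open>I0\<close>,
      \<open>F\<close> generates the extension of \<open>I\<close>; it is the minimal polynomial of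
      the class of the variable.\<close>
    ultimately obtain F where
      F: "F \<in> I" "lead_coeff F \<notin> I0" and Fmin: "\<And>q k. q \<in> I \<Longrightarrow> degree q < degree F \<Longrightarrow> coeff q k \<in> I0"
      using minimal_degree_element[OF id id0, of p0 k0] by metis
    have F0: "F \<noteq> 0" using F(2) ring_ideal_0[OF id0] by auto
    have degF: "degree F > 0"
    proof (rule ccontr)
      assume "\<not> ?thesis"
      then have "F = [:lead_coeff F:]" by (auto elim: degree_eq_zeroE)
      then have "[:lead_coeff F:] \<in> I" using F(1) by simp
      with F(2) show False by (simp add: I0_def)
    qed
    define J where "J = {p + q * f | p q. p \<in> I}"
    have J: "ring_ideal J" unfolding J_def by (rule ring_ideal_extend[OF id])
    have IJ: "p \<in> J" if "p \<in> I" for p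
      using that ideal_subset_extend[of I f] unfolding J_def by (rule rev_subsetD)
    have fJ: "f \<in> J" unfolding J_def by (rule generator_in_extend[OF id])
    have "[:x:] \<in> J" if "x \<in> I0" for x using that by (intro IJ) (simp add: I0_def)
    \<comment> \<open>In the same way \<open>g\<close> is a greatest common divisor of
      \<open>F\<close> and \<open>f\<close> over that fraction field.\<close>
    from minimal_degree_element[OF J id0 this IJ[OF F(1)] F(2)]
    obtain g where g: "g \<in> J" "lead_coeff g \<notin> I0" "degree g \<le> degree F"
      and gmin: "\<And>q k. q \<in> J \<Longrightarrow> degree q < degree g \<Longrightarrow> coeff q k \<in> I0" by metis
    have g0: "g \<noteq> 0" using g(2) ring_ideal_0[OF id0] by auto
    have lcpow: "lead_coeff h ^ k \<notin> I0" if "lead_coeff h \<notin> I0" for h k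
      using ring_prime_power[OF I0] that by blast
    have remI: "r \<in> I" if "smult (lead_coeff g ^ k) p = g * q + r" "r = 0 \<or> degree r < degree g" "p \<in> J"
      for p q r k
    proof -
      have "r = [:lead_coeff g ^ k:] * p - q * g" using that(1) by (simp add: mult.commute)
      then have "r \<in> J" using that(3) g(1) J by (auto intro!: ring_ideal_diff ring_ideal_mult simp del: mult_pCons_left)
      with that(2) gmin show ?thesis
        by (auto intro!: I0I ring_ideal_0[OF id0])
    qed
    \<comment> \<open>A nonconstant \<open>g\<close> would divide the irreducible \<open>F\<close>,
      so the cofactor \<open>q\<close> or \<open>g\<close> itself would lie in \<open>I\<close>. The
      cofactor has too small a degree, and \<open>g \<in> I\<close> would put \<open>f\<close> into
      \<open>I\<close>.\<close>
    have "degree g = 0"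
    proof (rule ccontr)
      assume deg: "degree g \<noteq> 0"
      obtain k q r where qr: "smult (lead_coeff g ^ k) F = g * q + r" "r = 0 \<or> degree r < degree g"
        by (rule pseudo_division[OF g0])
      have rI: "r \<in> I" by (rule remI[OF qr IJ[OF F(1)]])
      have "[:lead_coeff g ^ k:] * F - r = g * q" using qr(1) by simp
      moreover have "[:lead_coeff g ^ k:] * F - r \<in> I"
        using F(1) rI id by (intro ring_ideal_diff ring_ideal_mult)
      ultimately have "g \<in> I \<or> q \<in> I" using ring_primeD(3)[OF I] by simp
      moreover have "q \<notin> I"
      proof
        assume q: "q \<in> I"
        have "degree r < degree F" using qr(2) g(3) degF by auto
        have gq: "g * q = smult (lead_coeff g ^ k) F - r" using qr(1) by simp
        have lcF: "coeff (g * q) (degree F) = lead_coeff g ^ k * lead_coeff F"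
          using \<open>degree r < degree F\<close> by (simp add: gq coeff_eq_0)
        have "lead_coeff g ^ k * lead_coeff F \<notin> I0"
          using ring_primeD(3)[OF I0] lcpow[OF g(2)] F(2) by blast
        then have ne: "coeff (g * q) (degree F) \<noteq> 0" using lcF ring_ideal_0[OF id0] by metis
        have "degree (g * q) \<le> degree F"
          unfolding gq by (intro degree_diff_le) (use \<open>degree r < degree F\<close> in \<open>auto intro: degree_smult_le\<close>)
        with ne have dgq: "degree (g * q) = degree F" by (simp add: le_antisym le_degree)
        have "q \<noteq> 0" using ne by auto
        with g0 have "degree g + degree q = degree F" using dgq by (simp add: degree_mult_eq)
        with deg have "degree q < degree F" by simp
        then have "lead_coeff q \<in> I0" using Fmin q by blast
        then have "lead_coeff g * lead_coeff q \<in> I0" by (rule ring_ideal_mult[OF id0])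
        then have "lead_coeff (g * q) \<in> I0" by (simp add: lead_coeff_mult)
        with \<open>lead_coeff g ^ k * lead_coeff F \<notin> I0\<close> lcF dgq show False by simp
      qed
      ultimately have gI: "g \<in> I" by blast
      obtain k q r where qr: "smult (lead_coeff g ^ k) f = g * q + r" "r = 0 \<or> degree r < degree g"
        by (rule pseudo_division[OF g0])
      have "r \<in> I" by (rule remI[OF qr fJ])
      then have "g * q + r \<in> I" using gI id by (intro ring_ideal_add ring_ideal_mult2)
      then have "[:lead_coeff g ^ k:] * f \<in> I" using qr(1) by simp
      then have "[:lead_coeff g ^ k:] \<in> I" using ring_primeD(3)[OF I] f by blast
      with lcpow[OF g(2)] show False by (simp add: I0_def)
    qed
    then obtain a where a: "g = [:a:]" by (auto elim: degree_eq_zeroE)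
    have aI0: "a \<notin> I0" using g(2) by (simp add: a)
    \<comment> \<open>Where \<open>d\<close> does not vanish, the image of \<open>F\<close> keeps a
      positive degree and so has a root, and the identity \<open>[:a:] = p + q * f\<close> keeps
      \<open>f\<close> nonzero at that root.\<close>
    define d where "d = lead_coeff F * a"
    have "d \<notin> I0" using F(2) aI0 ring_primeD(3)[OF I0] by (auto simp: d_def)
    moreover have "\<exists>c. (\<forall>p\<in>I. poly (map_poly \<phi> p) c = 0) \<and> poly (map_poly \<phi> f) c \<noteq> 0"
      if \<phi>: "alg_closed TYPE('b)" "comm_ring_hom \<phi>" "\<forall>x. [:x:] \<in> I \<longrightarrow> \<phi> x = 0" "\<phi> d \<noteq> 0"
      for \<phi> :: "'a \<Rightarrow> 'b"
    proof -
      interpret comm_ring_hom \<phi> by fact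
      have lcF: "\<phi> (lead_coeff F) \<noteq> 0" and \<phi>a: "\<phi> a \<noteq> 0"
        using \<phi>(4) by (auto simp: d_def hom_mult)
      have "coeff (map_poly \<phi> F) (degree F) \<noteq> 0" using lcF by simp
      then have "degree F \<le> degree (map_poly \<phi> F)" by (rule le_degree)
      then obtain c where c: "poly (map_poly \<phi> F) c = 0"
        using \<phi>(1) degF unfolding alg_closed_def by (metis less_le_trans)
      interpret ev: comm_ring_hom "\<lambda>p. poly (map_poly \<phi> p) c"
        by (rule poly_map_poly_hom[OF \<phi>(2)])
      \<comment> \<open>Pseudo-division by \<open>F\<close> leaves a remainder with coefficients in
        \<open>I0\<close>, so every element of \<open>I\<close> vanishes at a root of the image of
        \<open>F\<close>.\<close>
      have zero: "poly (map_poly \<phi> p) c = 0" if p: "p \<in> I" for p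
      proof -
        obtain k q r where qr: "smult (lead_coeff F ^ k) p = F * q + r" "r = 0 \<or> degree r < degree F"
          by (rule pseudo_division[OF F0])
        have "r = [:lead_coeff F ^ k:] * p - q * F" using qr(1) by (simp add: mult.commute)
        then have "r \<in> I" using p F(1) id
          by (auto intro!: ring_ideal_diff ring_ideal_mult simp del: mult_pCons_left)
        then have "coeff r i \<in> I0" for i
          using qr(2) Fmin ring_ideal_0[OF id0] by (cases "r = 0") auto
        then have r0: "map_poly \<phi> r = 0"
          using \<phi>(3) by (intro map0 \<phi>(2)) (auto simp: I0_def)
        have "[:lead_coeff F ^ k:] * p = F * q + r" using qr(1) by simp
        then have "poly (map_poly \<phi> ([:lead_coeff F ^ k:] * p)) c = poly (map_poly \<phi> (F * q + r)) c"
          by simp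
        then have "\<phi> (lead_coeff F) ^ k * poly (map_poly \<phi> p) c = 0"
          unfolding ev.hom_mult ev.hom_add by (simp add: c r0 hom_power map_poly_const[OF \<phi>(2)])
        then show ?thesis using lcF by simp
      qed
      obtain p q where pq: "g = p + q * f" "p \<in> I"
        using g(1) unfolding J_def mem_Collect_eq by (elim exE conjE)
      have "\<phi> a = poly (map_poly \<phi> g) c" by (simp add: a map_poly_const[OF \<phi>(2)])
      then have "\<phi> a = poly (map_poly \<phi> (p + q * f)) c" by (simp only: pq(1))
      also have "\<dots> = poly (map_poly \<phi> q) c * poly (map_poly \<phi> f) c"
        unfolding ev.hom_add ev.hom_mult by (simp add: zero[OF pq(2)])
      finally show ?thesis using zero \<phi>a by (intro exI[of _ c]) auto
    qed
    ultimately show ?thesis by (auto simp: I0_def)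
  qed
qed

section \<open>The Nullstellensatz by induction on the number of variables\<close>

lemma mpoly_induct [case_names const var add mult]:
  fixes f :: "'k::comm_ring_1 mpoly"
  assumes "\<And>c. P (mconst c)" "\<And>i. P (mvar i)" "\<And>f g. P f \<Longrightarrow> P g \<Longrightarrow> P (f + g)" "\<And>f g. P f \<Longrightarrow> P g \<Longrightarrow> P (f * g)"
  shows "P f"
proof -
  have P01: "P 0" "P 1" using assms(1)[of 0] assms(1)[of 1] by (simp_all add: mconst_def)
  have sumI: "P (sum h S)" if "\<And>s. s \<in> S \<Longrightarrow> P (h s)" for h :: "(nat \<Rightarrow>\<^sub>0 nat) \<Rightarrow> 'k mpoly" and S
    using that by (induction S rule: infinite_finite_induct) (auto intro: P01 assms(3))
  have prodI: "P (prod h S)" if "\<And>s. s \<in> S \<Longrightarrow> P (h s)" for h :: "nat \<Rightarrow> 'k mpoly" and S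
    using that by (induction S rule: infinite_finite_induct) (auto intro: P01 assms(4))
  have powI: "P (h ^ k)" if "P h" for h k
    using that by (induction k) (auto intro: P01 assms(4))
  have "P (insertion mconst mvar f)"
    unfolding insertion_def monom_val_def
    by (intro sumI prodI powI assms)
  then show ?thesis by (simp add: insertion_mconst_mvar)
qed

lemma diff_insertion_in_ideal:
  assumes J: "ring_ideal J" and "\<And>i. mvar i - g i \<in> J"
  shows "f - insertion mconst g f \<in> J"
proof (induction f rule: mpoly_induct)
  case (const c)
  show ?case by (simp add: insertion_mconst[OF mconst_hom] ring_ideal_0[OF J])
next
  case (var i)
  show ?case by (simp add: insertion_mvar[OF mconst_hom] assms)
next
  case (add f h)
  have "f + h - insertion mconst g (f + h) = (f - insertion mconst g f) + (h - insertion mconst g h)"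
    by (simp add: insertion_add[OF mconst_hom])
  then show ?case using add J by (simp only: ring_ideal_add)
next
  case (mult f h)
  have "f * h - insertion mconst g (f * h)
      = h * (f - insertion mconst g f) + insertion mconst g f * (h - insertion mconst g h)"
    by (simp add: insertion_mult[OF mconst_hom] algebra_simps)
  then show ?case using mult J by (simp only: ring_ideal_add ring_ideal_mult)
qed

text \<open>Induction on \<open>m\<close>: \<open>mvar m\<close> becomes the variable of a
  univariate polynomial ring, the induction hypothesis gives a zero of the contraction of
  \<open>I\<close> to the remaining variables, and \<open>extend_points_to_poly\<close> finds the
  coordinate belonging to \<open>mvar m\<close>.\<close>

lemma nullstellensatz_prime:
  fixes I :: "'k::field mpoly set"
  assumes ac: "alg_closed TYPE('k)"
  shows "ring_prime I \<Longrightarrow> (\<And>i. i \<ge> m \<Longrightarrow> mvar i \<in> I) \<Longrightarrow> f \<notin> I \<Longrightarrow>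
    \<exists>w. (\<forall>p\<in>I. insertion (\<lambda>x. x) w p = 0) \<and> insertion (\<lambda>x. x) w f \<noteq> 0"
proof (induction m arbitrary: I f)
  case 0
  note id = ring_primeD(1)[OF 0(1)]
  have eq: "insertion mconst (\<lambda>_. 0) p = mconst (insertion (\<lambda>x. x) (\<lambda>_. 0) p)" for p :: "'k mpoly"
    by (simp add: hom_insertion[OF mconst_hom])
  \<comment> \<open>All variables lie in \<open>I\<close>, so every polynomial is congruent to its
    value at the origin.\<close>
  have *: "p - mconst (insertion (\<lambda>x. x) (\<lambda>_. 0) p) \<in> I" for p
    unfolding eq[symmetric] by (rule diff_insertion_in_ideal[OF id]) (simp add: 0(2))
  have "insertion (\<lambda>x. x) (\<lambda>_. 0) p = 0" if "p \<in> I" for p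
  proof (rule ccontr)
    assume ne: "insertion (\<lambda>x. x) (\<lambda>_. 0) p \<noteq> 0"
    have "mconst (insertion (\<lambda>x. x) (\<lambda>_. 0) p) \<in> I"
      using ring_ideal_diff[OF id that *[of p]] by simp
    then have "mconst (inverse (insertion (\<lambda>x. x) (\<lambda>_. 0) p)) * mconst (insertion (\<lambda>x. x) (\<lambda>_. 0) p) \<in> I"
      by (rule ring_ideal_mult[OF id])
    then have "1 \<in> I" using ne by (simp add: mconst.hom_mult[symmetric])
    with ring_primeD(2)[OF 0(1)] show False by simp
  qed
  moreover have "insertion (\<lambda>x. x) (\<lambda>_. 0) f \<noteq> 0"
    using *[of f] 0(3) by auto
  ultimately show ?case by blast
next
  case (Suc m)
  \<comment> \<open>\<open>hat p\<close> reads \<open>p\<close> as a polynomial in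
    \<open>mvar m\<close>; \<open>\<psi>\<close> substitutes \<open>mvar m\<close> back after
    \<open>\<rho>\<close> has killed the variables from \<open>m\<close> on in the coefficients. The
    composite is the identity modulo \<open>I\<close>.\<close>
  define \<rho> :: "'k mpoly \<Rightarrow> 'k mpoly" where "\<rho> = insertion mconst (\<lambda>i. if i < m then mvar i else 0)"
  have \<rho>: "comm_ring_hom \<rho>" unfolding \<rho>_def by (rule insertion_hom[OF mconst_hom])
  define \<psi> where "\<psi> q = poly (map_poly \<rho> q) (mvar m)" for q
  have \<psi>: "comm_ring_hom \<psi>" unfolding \<psi>_def by (rule poly_map_poly_hom[OF \<rho>])
  define hat :: "'k mpoly \<Rightarrow> 'k mpoly poly" where
    "hat = insertion (\<lambda>c. [:mconst c:]) (\<lambda>i. if i = m then [:0, 1:] else [:mvar i:])"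
  have \<psi>c: "\<psi> [:x:] = \<rho> x" for x
    by (simp add: \<psi>_def map_poly_const[OF \<rho>])
  have \<psi>X: "\<psi> [:0, 1:] = mvar m"
  proof -
    interpret comm_ring_hom \<rho> by (rule \<rho>)
    show ?thesis by (simp add: \<psi>_def)
  qed
  have \<psi>hat: "\<psi> (hat p) = insertion mconst (\<lambda>i. if i < Suc m then mvar i else 0) p" for p
  proof -
    have "\<psi> (hat p) = insertion (\<lambda>c. \<psi> [:mconst c:]) (\<lambda>i. \<psi> (if i = m then [:0, 1:] else [:mvar i:])) p"
      unfolding hat_def by (rule hom_insertion[OF \<psi>])
    also have "(\<lambda>c. \<psi> [:mconst c:]) = mconst"
      by (simp add: \<psi>c \<rho>_def insertion_mconst[OF mconst_hom])
    also have "(\<lambda>i. \<psi> (if i = m then [:0, 1:] else [:mvar i:])) = (\<lambda>i. if i < Suc m then mvar i else 0)"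
      by (auto simp: \<psi>X \<psi>c \<rho>_def insertion_mvar[OF mconst_hom])
    finally show ?thesis .
  qed
  note id = ring_primeD(1)[OF Suc.prems(1)]
  have "p - \<psi> (hat p) \<in> I" for p
    unfolding \<psi>hat by (rule diff_insertion_in_ideal[OF id]) (auto simp: Suc.prems(2) ring_ideal_0[OF id])
  then have hatI: "\<psi> (hat p) \<in> I \<longleftrightarrow> p \<in> I" for p
    using ring_ideal_diff[OF id, of p "p - \<psi> (hat p)"] ring_ideal_add[OF id, of "\<psi> (hat p)" "p - \<psi> (hat p)"]
    by auto
  define I' where "I' = {q. \<psi> q \<in> I}"
  have I': "ring_prime I'" unfolding I'_def by (rule ring_prime_vimage[OF \<psi> Suc.prems(1)])
  have "hat f \<notin> I'" using hatI[of f] Suc.prems(3) by (simp add: I'_def)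
  from extend_points_to_poly[OF I' this, where ?'b = 'k] ac obtain d where
    d: "[:d:] \<notin> I'" and lift: "\<And>\<phi>::'k mpoly \<Rightarrow> 'k. comm_ring_hom \<phi> \<Longrightarrow>
     (\<And>x. [:x:] \<in> I' \<Longrightarrow> \<phi> x = 0) \<Longrightarrow> \<phi> d \<noteq> 0 \<Longrightarrow>
     (\<exists>c. (\<forall>p\<in>I'. poly (map_poly \<phi> p) c = 0) \<and> poly (map_poly \<phi> (hat f)) c \<noteq> 0)"
    by metis
  define I0 where "I0 = {x. [:x:] \<in> I'}"
  have I0_eq: "I0 = {x. \<rho> x \<in> I}" by (simp add: I0_def I'_def \<psi>c)
  have "ring_prime I0" unfolding I0_eq by (rule ring_prime_vimage[OF \<rho> Suc.prems(1)])
  moreover have "mvar i \<in> I0" if "i \<ge> m" for i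
    using that by (simp add: I0_eq \<rho>_def insertion_mvar[OF mconst_hom] ring_ideal_0[OF id])
  moreover have "d \<notin> I0" using d by (simp add: I0_def)
  ultimately obtain w where w: "\<And>p. p \<in> I0 \<Longrightarrow> insertion (\<lambda>x. x) w p = 0" "insertion (\<lambda>x. x) w d \<noteq> 0"
    using Suc.IH[of I0 d] by blast
  define \<phi> where "\<phi> = insertion (\<lambda>x::'k. x) w"
  have \<phi>: "comm_ring_hom \<phi>" unfolding \<phi>_def by (rule insertion_hom[OF comm_ring_hom_id])
  interpret comm_ring_hom \<phi> by (rule \<phi>)
  obtain c where c: "\<And>p. p \<in> I' \<Longrightarrow> poly (map_poly \<phi> p) c = 0" "poly (map_poly \<phi> (hat f)) c \<noteq> 0"
    using lift[OF \<phi>] w by (auto simp: \<phi>_def I0_def)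
  have ev: "poly (map_poly \<phi> (hat p)) c = insertion (\<lambda>x. x) (w(m := c)) p" for p
  proof -
    have "poly (map_poly \<phi> (hat p)) c = insertion (\<lambda>x. poly (map_poly \<phi> [:mconst x:]) c)
       (\<lambda>i. poly (map_poly \<phi> (if i = m then [:0, 1:] else [:mvar i:])) c) p"
      unfolding hat_def by (rule hom_insertion[OF poly_map_poly_hom[OF \<phi>]])
    also have "(\<lambda>x. poly (map_poly \<phi> [:mconst x:]) c) = (\<lambda>x. x)"
      by (simp add: map_poly_const[OF \<phi>]) (simp add: \<phi>_def insertion_mconst[OF comm_ring_hom_id])
    also have "(\<lambda>i. poly (map_poly \<phi> (if i = m then [:0, 1:] else [:mvar i:])) c) = w(m := c)"
      by (rule ext) (simp add: map_poly_const[OF \<phi>] map_poly_pCons, simp add: \<phi>_def insertion_mvar[OF comm_ring_hom_id])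
    finally show ?thesis .
  qed
  show ?case
  proof (intro exI[of _ "w(m := c)"] conjI ballI)
    fix p assume "p \<in> I"
    then have "hat p \<in> I'" by (simp add: I'_def hatI)
    then show "insertion (\<lambda>x. x) (w(m := c)) p = 0" by (simp only: ev[symmetric] c(1))
  qed (rule c(2)[unfolded ev])
qed

lemma insertion_truncate:
  assumes "\<And>i. i \<in> mvars f \<Longrightarrow> i < m"
  shows "insertion mconst (\<lambda>i. if i < m then mvar i else 0) f = f"
proof -
  have "insertion mconst (\<lambda>i. if i < m then mvar i else 0) f = insertion mconst mvar f"
    by (rule insertion_cong) (use assms in auto)
  then show ?thesis by (simp add: insertion_mconst_mvar)
qed

text \<open>If no power of \<open>f\<close> lies in the ideal, some prime contains the ideal but not
  \<open>f\<close>, and this prime has a zero at which \<open>f\<close> does not vanish.\<close>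

theorem nullstellensatz:
  fixes g :: "nat \<Rightarrow> 'k::field mpoly"
  assumes ac: "alg_closed TYPE('k)" and fin: "finite J"
    and van: "\<And>w. (\<And>j. j \<in> J \<Longrightarrow> insertion (\<lambda>x. x) w (g j) = 0) \<Longrightarrow> insertion (\<lambda>x. x) w f = 0"
  shows "\<exists>N. f ^ N \<in> lincombs g J"
proof (rule ccontr)
  assume c: "\<not> ?thesis"
  define V where "V = mvars f \<union> (\<Union>j\<in>J. mvars (g j))"
  have "finite V" using fin by (auto simp: V_def finite_mvars)
  then obtain m where m: "\<And>i. i \<in> V \<Longrightarrow> i < m" by (meson finite_nat_set_iff_bounded)
  \<comment> \<open>There are infinitely many variables. Setting those from \<open>m\<close> on to
    zero yields an ideal that contains all but finitely many of them, as
    \<open>nullstellensatz_prime\<close> demands.\<close>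
  define \<kappa> :: "'k mpoly \<Rightarrow> 'k mpoly" where "\<kappa> = insertion mconst (\<lambda>i. if i < m then mvar i else 0)"
  have \<kappa>: "comm_ring_hom \<kappa>" unfolding \<kappa>_def by (rule insertion_hom[OF mconst_hom])
  interpret comm_ring_hom \<kappa> by (rule \<kappa>)
  have \<kappa>f: "\<kappa> f = f" and \<kappa>g: "\<And>j. j \<in> J \<Longrightarrow> \<kappa> (g j) = g j"
    unfolding \<kappa>_def by (rule insertion_truncate, use m in \<open>auto simp: V_def\<close>)+
  define I where "I = {p. \<kappa> p \<in> lincombs g J}"
  have I: "ring_ideal I" unfolding I_def by (rule ring_ideal_vimage[OF \<kappa> ring_ideal_lincombs])
  have "f ^ N \<notin> I" for N using c by (simp add: I_def hom_power \<kappa>f)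
  then obtain M where M: "ring_prime M" "I \<subseteq> M" "f \<notin> M"
    using prime_avoiding_powers[OF I] by metis
  have "mvar i \<in> M" if "i \<ge> m" for i
    using that M(2) by (auto simp: I_def \<kappa>_def insertion_mvar[OF mconst_hom])
  from nullstellensatz_prime[OF ac M(1) this M(3)] obtain w where
    w: "\<And>p. p \<in> M \<Longrightarrow> insertion (\<lambda>x. x) w p = 0" "insertion (\<lambda>x. x) w f \<noteq> 0" by blast
  have "insertion (\<lambda>x. x) w (g j) = 0" if "j \<in> J" for j
  proof -
    have "g j \<in> I" unfolding I_def mem_Collect_eq \<kappa>g[OF that] by (rule lincombs_gen[OF fin that])
    with M(2) show ?thesis by (intro w(1)) (rule subsetD)
  qed
  with van w(2) show False by blast
qed

section \<open>Algebraic independence\<close>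

text \<open>Gaussian elimination: a pivot \<open>a e v\<close> solves the equation \<open>e\<close>
  for the unknown \<open>v\<close>, and the remaining system has one equation and one unknown
  fewer.\<close>

lemma underdetermined_system:
  fixes a :: "'e \<Rightarrow> 'u \<Rightarrow> 'k::field"
  assumes "finite E" "finite U" "card E < card U"
  shows "\<exists>c. (\<exists>u\<in>U. c u \<noteq> 0) \<and> (\<forall>e\<in>E. (\<Sum>u\<in>U. a e u * c u) = 0)"
  using assms
proof (induction E arbitrary: U a rule: finite_induct)
  case empty
  then have "U \<noteq> {}" by auto
  then obtain u where "u \<in> U" by blast
  then show ?case by (intro exI[of _ "\<lambda>_. 1"]) auto
next
  case (insert e E)
  show ?case
  proof (cases "\<forall>u\<in>U. a e u = 0")
    case True
    have "card E < card U" using insert.prems(2) insert.hyps by simp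
    then obtain c where c: "\<exists>u\<in>U. c u \<noteq> 0" "\<forall>e\<in>E. (\<Sum>u\<in>U. a e u * c u) = 0"
      using insert.IH[OF insert.prems(1), of a] by blast
    have "(\<Sum>u\<in>U. a e u * c u) = 0" using True by (intro sum.neutral) simp
    then show ?thesis using c by blast
  next
    case False
    then obtain v where v: "v \<in> U" "a e v \<noteq> 0" by blast
    define b where "b f u = a f u - a f v / a e v * a e u" for f u
    have "card E < card (U - {v})" using insert.prems insert.hyps v by simp
    then obtain c where c: "\<exists>u\<in>U - {v}. c u \<noteq> 0" "\<forall>f\<in>E. (\<Sum>u\<in>U - {v}. b f u * c u) = 0"
      using insert.IH[of "U - {v}" b] insert.prems(1) by blast
    define S where "S = (\<Sum>u\<in>U - {v}. a e u * c u)"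
    define c' where "c' = c(v := - S / a e v)"
    have split: "(\<Sum>u\<in>U. a f u * c' u) = (\<Sum>u\<in>U - {v}. a f u * c u) - a f v * (S / a e v)" for f
    proof -
      have "(\<Sum>u\<in>U - {v}. a f u * c' u) = (\<Sum>u\<in>U - {v}. a f u * c u)"
        by (rule sum.cong) (simp_all add: c'_def)
      then show ?thesis
        using sum.remove[OF insert.prems(1) v(1), of "\<lambda>u. a f u * c' u"] by (simp add: c'_def)
    qed
    have "(\<Sum>u\<in>U. a f u * c' u) = 0" if "f \<in> insert e E" for f
    proof (cases "f = e")
      case True
      then show ?thesis using v(2) by (simp add: split S_def)
    next
      case False
      with that c(2) have "0 = (\<Sum>u\<in>U - {v}. b f u * c u)" by simp
      also have "\<dots> = (\<Sum>u\<in>U - {v}. a f u * c u) - a f v / a e v * S"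
        by (simp add: b_def S_def left_diff_distrib sum_subtractf sum_distrib_left mult.assoc)
      finally show ?thesis by (simp add: split)
    qed
    moreover have "\<exists>u\<in>U. c' u \<noteq> 0" using c(1) by (auto simp: c'_def)
    ultimately show ?thesis by blast
  qed
qed

text \<open>Bounding every exponent separately, rather than the total degree, makes the number of
  monomials the plain power \<open>Suc D ^ n\<close>.\<close>

definition monom_box :: "nat \<Rightarrow> nat \<Rightarrow> (nat \<Rightarrow>\<^sub>0 nat) set" where
  "monom_box n D = {m. Poly_Mapping.keys m \<subseteq> {..<n} \<and> (\<forall>i. Poly_Mapping.lookup m i \<le> D)}"

lemma monom_box_finite_card: "finite (monom_box n D)" "card (monom_box n D) = Suc D ^ n"
proof -
  define g where "g h = Abs_poly_mapping (\<lambda>i. if i < n then h i else (0::nat))" for h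
  have lookup_g: "Poly_Mapping.lookup (g h) = (\<lambda>i. if i < n then h i else 0)" for h
    unfolding g_def by (rule lookup_Abs_poly_mapping) (rule finite_subset[of _ "{..<n}"], auto)
  have inj: "inj_on g (PiE {..<n} (\<lambda>_. {..D}))"
  proof (rule inj_onI)
    fix x y assume xy: "x \<in> PiE {..<n} (\<lambda>_. {..D})" "y \<in> PiE {..<n} (\<lambda>_. {..D})" "g x = g y"
    have "x i = y i" if "i < n" for i
      using arg_cong[OF xy(3), of "\<lambda>p. Poly_Mapping.lookup p i"] that by (simp add: lookup_g)
    then show "x = y" using xy(1,2) by (intro PiE_ext) auto
  qed
  have "monom_box n D = g ` PiE {..<n} (\<lambda>_. {..D})"
  proof (intro equalityI subsetI)
    fix m assume "m \<in> monom_box n D"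
    then have keys: "Poly_Mapping.keys m \<subseteq> {..<n}" and le: "\<And>i. Poly_Mapping.lookup m i \<le> D"
      by (simp_all add: monom_box_def)
    have "Poly_Mapping.lookup m i = 0" if "\<not> i < n" for i
      using keys that by (metis in_keys_iff lessThan_iff subsetD)
    then have "m = g (\<lambda>i\<in>{..<n}. Poly_Mapping.lookup m i)"
      by (intro poly_mapping_eqI) (simp add: lookup_g)
    moreover have "(\<lambda>i\<in>{..<n}. Poly_Mapping.lookup m i) \<in> PiE {..<n} (\<lambda>_. {..D})"
      using le by (intro restrict_PiE_iff[THEN iffD2]) simp
    ultimately show "m \<in> g ` PiE {..<n} (\<lambda>_. {..D})" by (rule image_eqI)
  next
    fix m assume "m \<in> g ` PiE {..<n} (\<lambda>_. {..D})"
    then obtain h where h: "m = g h" "h \<in> PiE {..<n} (\<lambda>_. {..D})" by (rule imageE)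
    have "h i \<le> D" if "i < n" for i using PiE_mem[OF h(2)] that by simp
    then have "Poly_Mapping.lookup m i \<le> D" for i by (simp add: h(1) lookup_g)
    moreover have "i < n" if "i \<in> Poly_Mapping.keys m" for i
      using that unfolding in_keys_iff h(1) lookup_g by presburger
    ultimately show "m \<in> monom_box n D"
      by (simp add: monom_box_def subset_iff)
  qed
  then show "finite (monom_box n D)" "card (monom_box n D) = Suc D ^ n"
    using card_image[OF inj] by (simp_all add: finite_PiE card_PiE)
qed

lemma keys_mult_monom_box:
  assumes "Poly_Mapping.keys f \<subseteq> monom_box n D" "Poly_Mapping.keys g \<subseteq> monom_box n D'"
  shows "Poly_Mapping.keys (f * g) \<subseteq> monom_box n (D + D')"
proof
  fix m assume "m \<in> Poly_Mapping.keys (f * g)"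
  then obtain a b where m: "m = a + b" "a \<in> Poly_Mapping.keys f" "b \<in> Poly_Mapping.keys g"
    using keys_mult[of f g] by blast
  then have ab: "a \<in> monom_box n D" "b \<in> monom_box n D'" using assms by auto
  then have "Poly_Mapping.keys m \<subseteq> {..<n}" unfolding m(1)
    using keys_add[of a b] by (auto simp: monom_box_def)
  then show "m \<in> monom_box n (D + D')"
    using ab by (auto simp: monom_box_def m(1) lookup_add add_mono)
qed

lemma keys_power_monom_box:
  fixes f :: "'k::comm_ring_1 mpoly"
  assumes "Poly_Mapping.keys f \<subseteq> monom_box n D"
  shows "Poly_Mapping.keys (f ^ k) \<subseteq> monom_box n (k * D)"
proof (induction k)
  case 0
  then show ?case by (auto simp: monom_box_def)
next
  case (Suc k)
  then show ?case using keys_mult_monom_box[OF assms Suc] by simp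
qed

lemma monom_box_mono: "D \<le> D' \<Longrightarrow> monom_box n D \<subseteq> monom_box n D'"
  by (auto simp: monom_box_def intro: order_trans)

lemma keys_prod_monom_box:
  fixes f :: "'i \<Rightarrow> 'k::comm_ring_1 mpoly"
  assumes "\<And>i. i \<in> S \<Longrightarrow> Poly_Mapping.keys (f i) \<subseteq> monom_box n D"
  shows "Poly_Mapping.keys (prod f S) \<subseteq> monom_box n (card S * D)"
  using assms
proof (induction S rule: infinite_finite_induct)
  case (insert x S)
  then show ?case using keys_mult_monom_box[of "f x" n D "prod f S" "card S * D"] by simp
qed (auto simp: monom_box_def)

lemma keys_monom_box_exists:
  assumes "f \<in> coord_ring n"
  shows "\<exists>D. Poly_Mapping.keys f \<subseteq> monom_box n D"
proof -
  define D where "D = (\<Sum>m\<in>Poly_Mapping.keys f. \<Sum>i\<in>Poly_Mapping.keys m. Poly_Mapping.lookup m i)"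
  have "Poly_Mapping.lookup m i \<le> D" if "m \<in> Poly_Mapping.keys f" for m i
  proof (cases "i \<in> Poly_Mapping.keys m")
    case True
    then have "Poly_Mapping.lookup m i \<le> (\<Sum>i\<in>Poly_Mapping.keys m. Poly_Mapping.lookup m i)"
      by (intro member_le_sum) auto
    also have "\<dots> \<le> D" unfolding D_def by (rule member_le_sum[OF that]) auto
    finally show ?thesis .
  qed (simp add: in_keys_iff)
  then have "Poly_Mapping.keys f \<subseteq> monom_box n D"
    using assms by (auto simp: coord_ring_def mvars_def monom_box_def)
  then show ?thesis ..
qed

lemma lookup_mconst_mult: "Poly_Mapping.lookup (mconst c * f) m = c * Poly_Mapping.lookup f m"
  by (simp add: mconst_def mult_map_scale_conv_mult[symmetric] Poly_Mapping.map.rep_eq when_def)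

text \<open>Counting dimensions: the monomials with exponents at most \<open>d\<close> in
  \<open>n + 1\<close> of the \<open>F i\<close> number \<open>(d + 1) ^ (n + 1)\<close>, whereas
  their span lies in a space whose dimension grows like \<open>d ^ n\<close>. For large
  \<open>d\<close> there is a linear dependence, which is an algebraic relation.\<close>

theorem algebraically_independent_card_le:
  fixes F :: "nat \<Rightarrow> 'k::field mpoly"
  assumes F: "\<And>i. i < r \<Longrightarrow> F i \<in> coord_ring n"
    and indep: "\<And>p. p \<in> coord_ring r \<Longrightarrow> msubst F p = 0 \<Longrightarrow> p = 0"
  shows "r \<le> n"
proof (rule ccontr)
  assume "\<not> r \<le> n"
  define q where "q = Suc n"
  have q: "q \<le> r" using \<open>\<not> r \<le> n\<close> by (simp add: q_def)
  have "\<forall>i\<in>{..<r}. \<exists>D. Poly_Mapping.keys (F i) \<subseteq> monom_box n D"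
    using F by (auto intro: keys_monom_box_exists)
  then obtain D0 where D0: "\<And>i. i < r \<Longrightarrow> Poly_Mapping.keys (F i) \<subseteq> monom_box n (D0 i)"
    by (metis lessThan_iff)
  define D where "D = (\<Sum>i<r. D0 i)"
  have D: "Poly_Mapping.keys (F i) \<subseteq> monom_box n D" if "i < r" for i
    using D0[OF that] monom_box_mono[of "D0 i" D n] that member_le_sum[of i "{..<r}" D0]
    by (auto simp: D_def)
  \<comment> \<open>With this \<open>d\<close> the count works:
    \<open>q * d * D + 1 \<le> (q * D + 1) * (d + 1)\<close>, and the \<open>n\<close>-th power of
    the right-hand side is \<open>d * (d + 1) ^ n\<close>, below
    \<open>(d + 1) ^ (n + 1)\<close>.\<close>
  define d where "d = Suc (q * D) ^ n"
  define U where "U = monom_box q d"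
  define E where "E = monom_box n (q * (d * D))"
  have keysE: "Poly_Mapping.keys (monom_val F \<alpha>) \<subseteq> E" if "\<alpha> \<in> U" for \<alpha>
  proof -
    have \<alpha>: "Poly_Mapping.keys \<alpha> \<subseteq> {..<q}" "\<And>i. Poly_Mapping.lookup \<alpha> i \<le> d"
      using that by (auto simp: U_def monom_box_def)
    have "Poly_Mapping.keys (F i ^ Poly_Mapping.lookup \<alpha> i) \<subseteq> monom_box n (d * D)" if "i < q" for i
    proof -
      have "Poly_Mapping.keys (F i ^ Poly_Mapping.lookup \<alpha> i) \<subseteq> monom_box n (Poly_Mapping.lookup \<alpha> i * D)"
        using that q by (intro keys_power_monom_box D) simp
      also have "\<dots> \<subseteq> monom_box n (d * D)"
        by (intro monom_box_mono mult_le_mono1 \<alpha>(2))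
      finally show ?thesis .
    qed
    then have "Poly_Mapping.keys (monom_val F \<alpha>) \<subseteq> monom_box n (card {..<q} * (d * D))"
      unfolding monom_val_superset[OF finite_lessThan \<alpha>(1)] by (intro keys_prod_monom_box) auto
    then show ?thesis by (simp add: E_def)
  qed
  have "Suc (q * (d * D)) \<le> Suc (q * D) * Suc d" by (simp add: algebra_simps)
  then have "Suc (q * (d * D)) ^ n \<le> Suc (q * D) ^ n * Suc d ^ n"
    by (metis power_mono power_mult_distrib zero_le)
  also have "\<dots> < Suc d * Suc d ^ n" by (rule mult_strict_right_mono) (simp_all add: d_def)
  finally have "card E < card U" by (simp add: E_def U_def monom_box_finite_card q_def)
  then obtain c where c: "\<exists>\<alpha>\<in>U. c \<alpha> \<noteq> 0"
    "\<And>e. e \<in> E \<Longrightarrow> (\<Sum>\<alpha>\<in>U. Poly_Mapping.lookup (monom_val F \<alpha>) e * c \<alpha>) = 0"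
    using underdetermined_system[of E U "\<lambda>e \<alpha>. Poly_Mapping.lookup (monom_val F \<alpha>) e"]
    by (auto simp: E_def U_def monom_box_finite_card)
  define p where "p = (\<Sum>\<alpha>\<in>U. Poly_Mapping.single \<alpha> (c \<alpha>))"
  have finU: "finite U" by (simp add: U_def monom_box_finite_card)
  have lookup_p: "Poly_Mapping.lookup p \<alpha> = (if \<alpha> \<in> U then c \<alpha> else 0)" for \<alpha>
    using finU by (simp add: p_def lookup_sum lookup_single when_def)
  have "msubst F p = (\<Sum>\<alpha>\<in>U. mconst (c \<alpha>) * monom_val F \<alpha>)"
    by (simp add: msubst_insertion p_def insertion_sum[OF mconst_hom] insertion_single[OF mconst_hom])
  moreover have "Poly_Mapping.lookup (\<Sum>\<alpha>\<in>U. mconst (c \<alpha>) * monom_val F \<alpha>) e = 0" for e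
  proof (cases "e \<in> E")
    case True
    then show ?thesis using c(2) by (simp add: lookup_sum lookup_mconst_mult mult.commute)
  next
    case False
    then have "Poly_Mapping.lookup (monom_val F \<alpha>) e = 0" if "\<alpha> \<in> U" for \<alpha>
      using keysE[OF that] by (metis in_keys_iff subsetD)
    then show ?thesis by (simp add: lookup_sum lookup_mconst_mult)
  qed
  ultimately have "msubst F p = 0" by (intro poly_mapping_eqI) simp
  moreover have "i < r" if "\<alpha> \<in> Poly_Mapping.keys p" "i \<in> Poly_Mapping.keys \<alpha>" for i \<alpha>
  proof -
    have "\<alpha> \<in> U" using that(1) unfolding in_keys_iff lookup_p by presburger
    then have "Poly_Mapping.keys \<alpha> \<subseteq> {..<q}" by (simp add: U_def monom_box_def)
    with that(2) q show ?thesis by auto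
  qed
  then have "p \<in> coord_ring r" by (auto simp: coord_ring_def mvars_def)
  ultimately have "p = 0" by (simp add: indep)
  then have "c \<alpha> = 0" if "\<alpha> \<in> U" for \<alpha> using lookup_p[of \<alpha>] that by simp
  with c(1) show False by blast
qed

section \<open>Regular elements of polynomial rings\<close>

lemma mvars_mconst [simp]: "mvars (mconst c) = {}"
  by (simp add: mvars_def mconst_def)

lemma mvars_mvar [simp]: "mvars (mvar i :: 'k::comm_ring_1 mpoly) = {i}"
  by (simp add: mvars_def mvar_def)

lemma mvars_0 [simp]: "mvars 0 = {}"
  by (simp add: mvars_def)

lemma mvars_1 [simp]: "mvars 1 = {}"
  by (simp add: mvars_def)

lemma mvars_add: "mvars (f + g) \<subseteq> mvars f \<union> mvars g"
  using keys_add[of f g] by (fastforce simp: mvars_def)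

lemma mvars_mult: "mvars (f * g) \<subseteq> mvars f \<union> mvars g"
proof
  fix i assume "i \<in> mvars (f * g)"
  then obtain m where "m \<in> Poly_Mapping.keys (f * g)" "i \<in> Poly_Mapping.keys m"
    by (auto simp: mvars_def)
  then obtain a b where "a \<in> Poly_Mapping.keys f" "b \<in> Poly_Mapping.keys g" "i \<in> Poly_Mapping.keys (a + b)"
    using keys_mult[of f g] by blast
  then show "i \<in> mvars f \<union> mvars g"
    using keys_add[of a b] by (auto simp: mvars_def)
qed

lemma mvars_minus: "mvars (f - g) \<subseteq> mvars f \<union> mvars (g :: 'k::comm_ring_1 mpoly)"
proof -
  have "f - g = f + mconst (-1) * g" by (simp add: mconst.hom_uminus)
  then have "mvars (f - g) \<subseteq> mvars f \<union> mvars (mconst (-1) * g)" using mvars_add by metis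
  also have "\<dots> \<subseteq> mvars f \<union> mvars g" using mvars_mult[of "mconst (-1)" g] by auto
  finally show ?thesis .
qed

lemma mvars_sum: "mvars (sum f S) \<subseteq> (\<Union>s\<in>S. mvars (f s))"
proof (induction S rule: infinite_finite_induct)
  case (insert x S)
  then show ?case using mvars_add[of "f x" "sum f S"] by auto
qed auto

lemma mvars_prod: "mvars (prod f S) \<subseteq> (\<Union>s\<in>S. mvars (f s))"
proof (induction S rule: infinite_finite_induct)
  case (insert x S)
  then show ?case using mvars_mult[of "f x" "prod f S"] by auto
qed auto

lemma mvars_power: "mvars (f ^ k) \<subseteq> mvars (f :: 'k::comm_ring_1 mpoly)"
proof (induction k)
  case (Suc k)
  then show ?case using mvars_mult[of f "f ^ k"] by auto
qed auto

section \<open>Polynomials as univariate in one chosen variable\<close>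

definition to_univariate :: "nat \<Rightarrow> 'k::comm_ring_1 mpoly \<Rightarrow> 'k mpoly poly" where
  "to_univariate v = insertion (\<lambda>c. [:mconst c:]) (\<lambda>i. if i = v then [:0, 1:] else [:mvar i:])"

lemma const_poly_hom: "comm_ring_hom (\<lambda>x::'a::comm_ring_1. [:x:])"
  by unfold_locales auto

lemma to_univariate_hom: "comm_ring_hom (to_univariate v)"
  unfolding to_univariate_def
  by (rule insertion_hom[OF comm_ring_hom_comp[OF const_poly_hom mconst_hom]])

lemma to_univariate_const:
  assumes "v \<notin> mvars f"
  shows "to_univariate v f = [:f:]"
proof (rule hom_eqI[OF to_univariate_hom const_poly_hom])
  note h = comm_ring_hom_comp[OF const_poly_hom mconst_hom]
  show "to_univariate v (mconst c) = [:mconst c:]" for c :: 'a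
    unfolding to_univariate_def by (rule insertion_mconst[OF h])
  show "to_univariate v (mvar i) = [:mvar i:]" if "i \<in> mvars f" for i
    unfolding to_univariate_def insertion_mvar[OF h] using that assms by auto
qed

lemma to_univariate_mvar: "to_univariate v (mvar v) = [:0, 1:]"
  unfolding to_univariate_def
  by (subst insertion_mvar[OF comm_ring_hom_comp[OF const_poly_hom mconst_hom]]) simp

lemma poly_to_univariate: "poly (to_univariate v f) (mvar v) = f"
proof -
  have h: "comm_ring_hom (\<lambda>p::'a mpoly poly. poly p (mvar v))" by unfold_locales auto
  have "poly (to_univariate v f) (mvar v) = insertion (\<lambda>c. poly [:mconst c:] (mvar v))
      (\<lambda>i. poly (if i = v then [:0, 1:] else [:mvar i:]) (mvar v)) f"
    unfolding to_univariate_def by (rule hom_insertion[OF h])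
  also have "\<dots> = insertion mconst mvar f"
    by (rule arg_cong2[where f = "\<lambda>a b. insertion a b f"]) auto
  finally show ?thesis by (simp add: insertion_mconst_mvar)
qed

text \<open>Generators free of \<open>v\<close> become constants in the univariate ring, so
  membership in their ideal can be tested on the coefficient of each power of
  \<open>v\<close>.\<close>

lemma lincombs_coeff_to_univariate:
  assumes "\<And>j. j \<in> J \<Longrightarrow> v \<notin> mvars (g j)"
  shows "f \<in> lincombs g J \<longleftrightarrow> (\<forall>k. coeff (to_univariate v f) k \<in> lincombs g J)"
proof
  interpret comm_ring_hom "to_univariate v" by (rule to_univariate_hom)
  assume "f \<in> lincombs g J"
  then obtain r where "f = (\<Sum>j\<in>J. r j * g j)" by (elim lincombsE)
  then have "to_univariate v f = (\<Sum>j\<in>J. to_univariate v (r j) * [:g j:])"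
    by (simp add: hom_sum hom_mult to_univariate_const[OF assms] del: mult_pCons_right)
  then have "coeff (to_univariate v f) k = (\<Sum>j\<in>J. coeff (to_univariate v (r j)) k * g j)" for k
    by (simp add: coeff_sum mult.commute)
  then show "\<forall>k. coeff (to_univariate v f) k \<in> lincombs g J" by (simp add: lincombsI)
next
  assume "\<forall>k. coeff (to_univariate v f) k \<in> lincombs g J"
  then have "(\<Sum>k\<le>degree (to_univariate v f). mvar v ^ k * coeff (to_univariate v f) k) \<in> lincombs g J"
    by (intro lincombs_sum lincombs_mult) simp
  moreover have "(\<Sum>k\<le>degree (to_univariate v f). mvar v ^ k * coeff (to_univariate v f) k) = f"
    using poly_to_univariate[of v f] by (simp add: poly_altdef mult.commute)
  ultimately show "f \<in> lincombs g J" by simp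
qed

text \<open>Coefficient \<open>k + 1\<close> of the product is \<open>q_k - c * q_(k+1)\<close>.
  Starting above the degree, where the coefficients vanish, each coefficient of \<open>q\<close> is
  seen to lie in the ideal from the one above it.\<close>

lemma monic_linear_regular:
  assumes J: "\<And>j. j \<in> J \<Longrightarrow> v \<notin> mvars (g j)" and c: "v \<notin> mvars c"
    and p: "(mvar v - c) * p \<in> lincombs g J"
  shows "p \<in> lincombs g J"
proof -
  interpret comm_ring_hom "to_univariate v" by (rule to_univariate_hom)
  define q where "q = to_univariate v p"
  have "to_univariate v ((mvar v - c) * p) = pCons 0 q - smult c q"
    by (simp add: hom_mult hom_minus to_univariate_mvar to_univariate_const[OF c] q_def)
  then have *: "coeff (pCons 0 q - smult c q) k \<in> lincombs g J" for k
    using iffD1[OF lincombs_coeff_to_univariate[of J v g, OF J] p] by metis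
  have step: "coeff q k \<in> lincombs g J" if "coeff q (Suc k) \<in> lincombs g J" for k
    using lincombs_add[OF *[of "Suc k"] lincombs_mult[OF that, of c]] by simp
  have high: "\<forall>k. degree q < k + j \<longrightarrow> coeff q k \<in> lincombs g J" for j
  proof (induction j)
    case 0
    then show ?case by (simp add: coeff_eq_0)
  next
    case (Suc j)
    show ?case
    proof (intro allI impI)
      fix k assume "degree q < k + Suc j"
      then have "degree q < Suc k + j" by simp
      then show "coeff q k \<in> lincombs g J" by (rule step[OF Suc[rule_format]])
    qed
  qed
  have "coeff q k \<in> lincombs g J" for k
    using high[of "Suc (degree q)"] by simp
  then have "\<forall>k. coeff (to_univariate v p) k \<in> lincombs g J" by (simp add: q_def)
  moreover have "p \<in> lincombs g J \<longleftrightarrow> (\<forall>k. coeff (to_univariate v p) k \<in> lincombs g J)"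
    by (rule lincombs_coeff_to_univariate) (rule J)
  ultimately show ?thesis by (rule iffD2[rotated])
qed

lemma prod_regular:
  assumes "\<And>s p. s \<in> S \<Longrightarrow> f s * p \<in> lincombs g J \<Longrightarrow> p \<in> lincombs g J"
    and "prod f S * p \<in> lincombs g J"
  shows "p \<in> lincombs g J"
  using assms
proof (induction S arbitrary: p rule: infinite_finite_induct)
  case (insert x S)
  have "f x * (prod f S * p) \<in> lincombs g J" using insert.prems(2) insert.hyps by (simp add: mult.assoc)
  then have "prod f S * p \<in> lincombs g J" by (rule insert.prems(1)[OF insertI1])
  then show ?case using insert.IH insert.prems(1) by (metis insertI2)
qed simp_all

lemma power_regular:
  assumes "\<And>p. x * p \<in> lincombs g J \<Longrightarrow> p \<in> lincombs g J"
    and "x ^ N * p \<in> lincombs g J"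
  shows "p \<in> lincombs g J"
  using prod_regular[of "{..<N}" "\<lambda>_. x" g J p] assms by simp

section \<open>Linear forms and cancellation modulo products of them\<close>

definition lin_form :: "nat \<Rightarrow> (nat \<Rightarrow> 'k::comm_ring_1) \<Rightarrow> 'k mpoly" where
  "lin_form n c = (\<Sum>j<n. mconst (c j) * mvar j)"

lemma insertion_lin_form:
  assumes "comm_ring_hom \<phi>"
  shows "insertion \<phi> g (lin_form n c) = (\<Sum>j<n. \<phi> (c j) * g j)"
  by (simp add: lin_form_def insertion_sum[OF assms] insertion_mult[OF assms]
      insertion_mconst[OF assms] insertion_mvar[OF assms])

lemma mvars_lin_form: "mvars (lin_form n c) \<subseteq> {..<n}"
proof -
  have "mvars (mconst (c j) * mvar j) \<subseteq> {j}" for j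
    using mvars_mult[of "mconst (c j)" "mvar j"] by simp
  then show ?thesis unfolding lin_form_def using mvars_sum by fastforce
qed

text \<open>The substitution that solves the first form for the variable \<open>j0\<close> is
  reduction modulo that form, with values in a domain. The point \<open>x\<close> shows that the
  second form does not reduce to zero, so it can be cancelled.\<close>

lemma lin_form_prime:
  fixes c c' :: "nat \<Rightarrow> 'k::field"
  assumes x: "(\<Sum>j<n. c j * x j) = 0" "(\<Sum>j<n. c' j * x j) \<noteq> 0"
    and j0: "j0 < n" "c j0 \<noteq> 0" and dvd: "lin_form n c dvd lin_form n c' * p"
  shows "lin_form n c dvd p"
proof -
  define g where "g = mvar(j0 := mvar j0 - mconst (inverse (c j0)) * lin_form n c)"
  define \<phi> where "\<phi> = insertion mconst g"
  interpret comm_ring_hom \<phi> unfolding \<phi>_def by (rule insertion_hom[OF mconst_hom])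
  have \<phi>c: "\<phi> (lin_form n c) = 0"
  proof -
    have "\<phi> (lin_form n c) = (\<Sum>j<n. mconst (c j) * g j)"
      unfolding \<phi>_def by (rule insertion_lin_form[OF mconst_hom])
    also have "\<dots> = (\<Sum>j<n. mconst (c j) * mvar j
        - (if j = j0 then mconst (c j0) * mconst (inverse (c j0)) * lin_form n c else 0))"
      by (rule sum.cong) (auto simp: g_def algebra_simps)
    also have "\<dots> = 0"
      using j0 by (simp add: sum_subtractf mconst.hom_mult[symmetric] lin_form_def)
    finally show ?thesis .
  qed
  have ideal: "ring_ideal {q. lin_form n c dvd q}" by (simp add: ring_ideal_def)
  have diff: "lin_form n c dvd f - \<phi> f" for f
    using diff_insertion_in_ideal[OF ideal, of g f] by (auto simp: \<phi>_def g_def)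
  have \<phi>c': "\<phi> (lin_form n c') \<noteq> 0"
  proof
    assume 0: "\<phi> (lin_form n c') = 0"
    note ev = insertion_hom[OF comm_ring_hom_id, of x]
    interpret ev: comm_ring_hom "insertion (\<lambda>x. x) x" by (rule ev)
    have g: "insertion (\<lambda>x. x) x (g j) = x j" for j
      by (simp add: g_def insertion_mvar[OF comm_ring_hom_id] ev.hom_minus ev.hom_mult
          insertion_lin_form[OF comm_ring_hom_id] x(1))
    have "insertion (\<lambda>x. x) x (\<phi> (lin_form n c')) = (\<Sum>j<n. c' j * x j)"
      unfolding \<phi>_def insertion_lin_form[OF mconst_hom]
      by (simp add: ev.hom_sum ev.hom_mult g insertion_mconst[OF comm_ring_hom_id])
    with 0 x(2) show False by (simp add: insertion_0)
  qed
  obtain q where "lin_form n c' * p = lin_form n c * q" using dvd by (elim dvdE)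
  then have "\<phi> (lin_form n c') * \<phi> p = 0" by (metis hom_mult \<phi>c mult_zero_left)
  with \<phi>c' have "\<phi> p = 0" by simp
  with diff[of p] show ?thesis by simp
qed

text \<open>\<open>t\<close> is a nonzerodivisor modulo \<open>s\<close>. This is the version of
  coprimality that a regular sequence beginning with \<open>s\<close>, \<open>t\<close> asks for,
  and over a domain it passes to products and powers on both sides.\<close>

definition dvd_cancel :: "'a::comm_ring_1 \<Rightarrow> 'a \<Rightarrow> bool" where
  "dvd_cancel s t \<longleftrightarrow> (\<forall>p. s dvd t * p \<longrightarrow> s dvd p)"

lemma dvd_cancelD: "dvd_cancel s t \<Longrightarrow> s dvd t * p \<Longrightarrow> s dvd p"
  unfolding dvd_cancel_def by (drule spec, erule mp)

lemma dvd_cancel_1: "dvd_cancel s 1" "dvd_cancel 1 t"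
  by (simp_all add: dvd_cancel_def)

lemma dvd_cancel_mult_right:
  assumes "dvd_cancel s t" "dvd_cancel s t'"
  shows "dvd_cancel s (t * t')"
  unfolding dvd_cancel_def
proof (intro allI impI)
  fix p assume "s dvd t * t' * p"
  then have "s dvd t * (t' * p)" by (simp only: mult.assoc)
  from dvd_cancelD[OF assms(2) dvd_cancelD[OF assms(1) this]] show "s dvd p" .
qed

lemma dvd_cancel_mult_left:
  fixes s s' t :: "'a::idom"
  assumes "dvd_cancel s t" "dvd_cancel s' t"
  shows "dvd_cancel (s * s') t"
  unfolding dvd_cancel_def
proof (intro allI impI)
  fix p assume p: "s * s' dvd t * p"
  show "s * s' dvd p"
  proof (cases "s = 0")
    case True
    with p have "s dvd t * p" by simp
    from dvd_cancelD[OF assms(1) this] True show ?thesis by simp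
  next
    case False
    from p have "s dvd t * p" by (rule dvd_mult_left)
    from dvd_cancelD[OF assms(1) this] obtain p' where p': "p = s * p'" by (elim dvdE)
    have "s * s' dvd s * (t * p')" using p by (simp only: p' mult.left_commute)
    then have "s' dvd t * p'" using False by simp
    from dvd_cancelD[OF assms(2) this] show ?thesis by (simp add: p')
  qed
qed

lemma dvd_cancel_prod_right:
  assumes "\<And>i. i \<in> S \<Longrightarrow> dvd_cancel s (f i)"
  shows "dvd_cancel s (prod f S)"
  using assms by (induction S rule: infinite_finite_induct) (simp_all add: dvd_cancel_1 dvd_cancel_mult_right)

lemma dvd_cancel_prod_left:
  fixes t :: "'a::idom"
  assumes "\<And>i. i \<in> S \<Longrightarrow> dvd_cancel (f i) t"
  shows "dvd_cancel (prod f S) t"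
  using assms by (induction S rule: infinite_finite_induct) (simp_all add: dvd_cancel_1 dvd_cancel_mult_left)

lemma dvd_cancel_power:
  fixes s t :: "'a::idom"
  assumes "dvd_cancel s t"
  shows "dvd_cancel (s ^ k) (t ^ l)"
  using dvd_cancel_prod_left[of "{..<k}" "\<lambda>_. s" "t ^ l"] dvd_cancel_prod_right[of "{..<l}" s "\<lambda>_. t"] assms
  by simp

section \<open>Orbit separation\<close>

lemma mvars_insertion:
  assumes "\<And>c. mvars (\<phi> c) \<subseteq> S" "\<And>i. i \<in> mvars f \<Longrightarrow> mvars (g i) \<subseteq> S"
  shows "mvars (insertion \<phi> g f) \<subseteq> S"
proof -
  have "mvars (monom_val g m) \<subseteq> S" if "m \<in> Poly_Mapping.keys f" for m
    unfolding monom_val_def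
  proof (rule order_trans[OF mvars_prod], rule UN_least, rule order_trans[OF mvars_power])
    fix i assume "i \<in> Poly_Mapping.keys m"
    with that show "mvars (g i) \<subseteq> S" by (intro assms(2)) (auto simp: mvars_def)
  qed
  then show ?thesis
    unfolding insertion_def using assms(1)
    by (intro order_trans[OF mvars_sum] UN_least order_trans[OF mvars_mult] Un_least)
qed

text \<open>Each \<open>d x\<close> is the coefficient vector of a nonzero polynomial in
  \<open>\<theta>\<close>; over an infinite field some \<open>\<theta>\<close> is a root of none of
  them.\<close>

lemma moment_curve_avoids:
  fixes d :: "'d \<Rightarrow> nat \<Rightarrow> 'k::field"
  assumes inf: "infinite (UNIV :: 'k set)" and D: "finite D" "\<And>x. x \<in> D \<Longrightarrow> \<exists>i<n. d x i \<noteq> 0"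
  obtains \<theta> where "\<And>x. x \<in> D \<Longrightarrow> (\<Sum>i<n. \<theta> ^ i * d x i) \<noteq> 0"
proof -
  define p where "p x = (\<Sum>i<n. monom (d x i) i)" for x
  have "p x \<noteq> 0" if x: "x \<in> D" for x
  proof -
    obtain i where i: "i < n" "d x i \<noteq> 0" using D(2)[OF x] by blast
    have "coeff (p x) i = d x i" using i(1) by (simp add: p_def coeff_sum)
    with i(2) show ?thesis by (metis coeff_0)
  qed
  then have "prod p D \<noteq> 0" using D(1) by simp
  then obtain \<theta> where "poly (prod p D) \<theta> \<noteq> 0" by (rule infinite_field_nonroot[OF inf])
  then have "poly (p x) \<theta> \<noteq> 0" if "x \<in> D" for x
    using that D(1) by (auto simp: poly_prod)
  then show ?thesis
    by (intro that) (simp add: p_def poly_sum poly_monom mult.commute)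
qed

lemma map_poly_comm_ring_hom:
  assumes "comm_ring_hom \<phi>"
  shows "comm_ring_hom (map_poly \<phi>)"
proof -
  interpret comm_ring_hom \<phi> by fact
  interpret m: map_poly_comm_ring_hom \<phi> ..
  show ?thesis by (rule m.comm_ring_hom_axioms)
qed

text \<open>The coordinates of \<open>M\<close> times the generic vector; substituting them for the
  variables composes a polynomial function with \<open>M\<close>.\<close>

definition mat_forms :: "nat \<Rightarrow> 'k::comm_ring_1 mat \<Rightarrow> nat \<Rightarrow> 'k mpoly" where
  "mat_forms n M i = lin_form n (\<lambda>j. M $$ (i, j))"

lemma insertion_mat_forms:
  fixes M N :: "'k::comm_ring_1 mat"
  assumes "M \<in> carrier_mat n n" "N \<in> carrier_mat n n" "i < n"
  shows "insertion mconst (mat_forms n N) (mat_forms n M i) = mat_forms n (M * N) i"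
proof -
  have "insertion mconst (mat_forms n N) (mat_forms n M i)
      = (\<Sum>j<n. mconst (M $$ (i, j)) * (\<Sum>k<n. mconst (N $$ (j, k)) * mvar k))"
    unfolding mat_forms_def insertion_lin_form[OF mconst_hom] by (simp add: lin_form_def)
  also have "\<dots> = (\<Sum>k<n. (\<Sum>j<n. mconst (M $$ (i, j)) * mconst (N $$ (j, k))) * mvar k)"
    unfolding sum_distrib_left sum_distrib_right by (subst sum.swap) (simp add: mult.assoc)
  also have "\<dots> = (\<Sum>k<n. mconst ((M * N) $$ (i, k)) * mvar k)"
    using assms by (simp add: scalar_prod_def mconst.hom_sum mconst.hom_mult atLeast0LessThan)
  finally show ?thesis by (simp add: mat_forms_def lin_form_def)
qed

text \<open>The coefficients in $T$ and $\theta$ of $\prod_{M} (T - \sum_i \theta^i (Mx)_i)$ are invariant, and they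
  determine the multiset of the vectors $Mx$.\<close>

definition orbit_factor :: "nat \<Rightarrow> 'k::comm_ring_1 mat \<Rightarrow> 'k mpoly poly poly" where
  "orbit_factor n M = [:- (\<Sum>i<n. monom (mat_forms n M i) i), 1:]"

text \<open>If no \<open>M\<close> in \<open>W\<close> takes \<open>u\<close> to \<open>v\<close>, a
  generic \<open>\<theta>\<close> keeps \<open>T = (\<Sum>i<n. \<theta> ^ i * v i)\<close> apart
  from the corresponding numbers of all \<open>M u\<close>. Evaluated at \<open>T\<close> and
  \<open>\<theta>\<close>, the product \<open>\<Phi>\<close> then vanishes at \<open>v\<close>,
  thanks to the identity matrix in \<open>W\<close>, but not at \<open>u\<close>.\<close>

lemma invariants_separate_orbits:
  fixes \<iota> :: "'k::field \<Rightarrow> 'K::field" and W :: "'k mat set"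
  assumes \<iota>: "comm_ring_hom \<iota>" and inf: "infinite (UNIV :: 'K set)"
    and W: "finite W" "W \<subseteq> carrier_mat n n" "1\<^sub>m n \<in> W"
    and bij: "\<And>N. N \<in> W \<Longrightarrow> bij_betw (\<lambda>M. M * N) W W"
    and eq: "\<And>f. f \<in> coord_ring n \<Longrightarrow> (\<And>N. N \<in> W \<Longrightarrow> insertion mconst (mat_forms n N) f = f) \<Longrightarrow>
      insertion \<iota> u f = insertion \<iota> v f"
  shows "\<exists>M\<in>W. \<forall>i<n. v i = (\<Sum>j<n. \<iota> (M $$ (i, j)) * u j)"
proof (rule ccontr)
  assume "\<not> ?thesis"
  then have no: "\<not> (\<forall>i<n. v i = (\<Sum>j<n. \<iota> (M $$ (i, j)) * u j))" if "M \<in> W" for M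
    using that by blast
  have ne: "\<exists>i<n. v i - (\<Sum>j<n. \<iota> (M $$ (i, j)) * u j) \<noteq> 0" if "M \<in> W" for M
    using no[OF that] by (simp only: not_all not_imp right_minus_eq)
  obtain \<theta> where \<theta>: "\<And>M. M \<in> W \<Longrightarrow> (\<Sum>i<n. \<theta> ^ i * (v i - (\<Sum>j<n. \<iota> (M $$ (i, j)) * u j))) \<noteq> 0"
    by (rule moment_curve_avoids[OF inf W(1), of n "\<lambda>M i. v i - (\<Sum>j<n. \<iota> (M $$ (i, j)) * u j)"])
       (use ne in blast)+
  define \<Phi> where "\<Phi> = prod (orbit_factor n) W"
  \<comment> \<open>Substituting \<open>N\<close> multiplies the index of each factor by
    \<open>N\<close> on the right, which permutes \<open>W\<close>.\<close>
  have inv: "insertion mconst (mat_forms n N) (coeff (coeff \<Phi> a) b) = coeff (coeff \<Phi> a) b" if N: "N \<in> W" for N a b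
  proof -
    let ?\<alpha> = "insertion mconst (mat_forms n N)"
    have \<alpha>: "comm_ring_hom ?\<alpha>" by (rule insertion_hom[OF mconst_hom])
    interpret \<alpha>: comm_ring_hom ?\<alpha> by (rule \<alpha>)
    interpret m\<alpha>: comm_ring_hom "map_poly ?\<alpha>" by (rule map_poly_comm_ring_hom[OF \<alpha>])
    interpret mm\<alpha>: comm_ring_hom "map_poly (map_poly ?\<alpha>)" by (rule map_poly_comm_ring_hom) unfold_locales
    have "map_poly (map_poly ?\<alpha>) (orbit_factor n M) = orbit_factor n (M * N)" if "M \<in> W" for M
    proof -
      have "map_poly ?\<alpha> (\<Sum>i<n. monom (mat_forms n M i) i) = (\<Sum>i<n. monom (mat_forms n (M * N) i) i)"
        unfolding m\<alpha>.hom_sum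
        by (rule sum.cong)
           (simp_all add: map_poly_monom insertion_mat_forms[OF subsetD[OF W(2) that] subsetD[OF W(2) N]])
      then show ?thesis by (simp add: orbit_factor_def map_poly_pCons m\<alpha>.hom_uminus)
    qed
    then have "map_poly (map_poly ?\<alpha>) \<Phi> = (\<Prod>M\<in>W. orbit_factor n (M * N))"
      by (simp add: \<Phi>_def mm\<alpha>.hom_prod)
    also have "\<dots> = \<Phi>" unfolding \<Phi>_def by (rule prod.reindex_bij_betw[OF bij[OF N]])
    finally have "coeff (coeff (map_poly (map_poly ?\<alpha>) \<Phi>) a) b = coeff (coeff \<Phi> a) b" by simp
    then show ?thesis by (simp add: coeff_map_poly)
  qed
  have eqc: "insertion \<iota> u (coeff (coeff \<Phi> a) b) = insertion \<iota> v (coeff (coeff \<Phi> a) b)" for a b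
  proof (rule eq)
    have "mvars (insertion mconst (mat_forms n (1\<^sub>m n)) (coeff (coeff \<Phi> a) b)) \<subseteq> {..<n}"
      by (rule mvars_insertion) (simp_all add: mat_forms_def mvars_lin_form)
    then show "coeff (coeff \<Phi> a) b \<in> coord_ring n"
      using inv[OF W(3), of a b] by (simp add: coord_ring_def)
  qed (rule inv)
  define T where "T = (\<Sum>i<n. \<theta> ^ i * v i)"
  define E where "E w p = poly (map_poly (\<lambda>q. poly (map_poly (insertion \<iota> w) q) \<theta>) p) T"
    for w and p :: "'k mpoly poly poly"
  have E\<Phi>: "E w \<Phi> = (\<Prod>M\<in>W. T - (\<Sum>i<n. \<theta> ^ i * (\<Sum>j<n. \<iota> (M $$ (i, j)) * w j)))" for w
  proof -
    have ins: "comm_ring_hom (insertion \<iota> w)" by (rule insertion_hom[OF \<iota>])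
    have h: "comm_ring_hom (\<lambda>q. poly (map_poly (insertion \<iota> w) q) \<theta>)" by (rule poly_map_poly_hom[OF ins])
    interpret h: comm_ring_hom "\<lambda>q. poly (map_poly (insertion \<iota> w) q) \<theta>" by (rule h)
    interpret E: comm_ring_hom "E w" unfolding E_def by (rule poly_map_poly_hom[OF h])
    have "poly (map_poly (insertion \<iota> w) (monom (mat_forms n M i) i)) \<theta> = \<theta> ^ i * (\<Sum>j<n. \<iota> (M $$ (i, j)) * w j)"
      for M i by (simp add: map_poly_monom insertion_0 poly_monom mat_forms_def insertion_lin_form[OF \<iota>] mult.commute)
    then have "E w (orbit_factor n M) = T - (\<Sum>i<n. \<theta> ^ i * (\<Sum>j<n. \<iota> (M $$ (i, j)) * w j))" for M
      by (simp add: E_def orbit_factor_def map_poly_pCons h.hom_uminus h.hom_sum insertion_0 insertion_1[OF \<iota>])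
    then show ?thesis by (simp add: \<Phi>_def E.hom_prod)
  qed
  have "map_poly (insertion \<iota> u) (coeff \<Phi> a) = map_poly (insertion \<iota> v) (coeff \<Phi> a)" for a
    by (rule poly_eqI) (simp add: coeff_map_poly insertion_0 eqc)
  then have "map_poly (\<lambda>q. poly (map_poly (insertion \<iota> u) q) \<theta>) \<Phi> = map_poly (\<lambda>q. poly (map_poly (insertion \<iota> v) q) \<theta>) \<Phi>"
    by (intro poly_eqI) (simp add: coeff_map_poly)
  then have "E u \<Phi> = E v \<Phi>" by (simp add: E_def)
  also have "\<dots> = 0"
  proof -
    have "(\<Sum>j<n. \<iota> (1\<^sub>m n $$ (i, j)) * v j) = v i" if "i < n" for i
    proof -
      interpret \<iota>: comm_ring_hom \<iota> by (rule \<iota>)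
      have "(\<Sum>j<n. \<iota> (1\<^sub>m n $$ (i, j)) * v j) = (\<Sum>j<n. if j = i then v i else 0)"
        by (rule sum.cong) (use that in auto)
      then show ?thesis using that by simp
    qed
    then have "T - (\<Sum>i<n. \<theta> ^ i * (\<Sum>j<n. \<iota> (1\<^sub>m n $$ (i, j)) * v j)) = 0"
      by (simp add: T_def)
    then show ?thesis unfolding E\<Phi> using W(1,3) by (intro prod_zero) blast+
  qed
  finally obtain M where M: "M \<in> W" "T - (\<Sum>i<n. \<theta> ^ i * (\<Sum>j<n. \<iota> (M $$ (i, j)) * u j)) = 0"
    unfolding E\<Phi> using W(1) by auto
  then show False
    using \<theta>[OF M(1)] by (simp add: T_def right_diff_distrib sum_subtractf)
qed

section \<open>Graphs of linear maps in a complete intersection\<close>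

text \<open>Every term of the binomial expansion contains \<open>A ^ k\<close> or
  \<open>B ^ l\<close>. Raising a decomposition to a high power thus keeps its shape, while products
  that are nilpotent modulo an ideal become members of it.\<close>

lemma power_add_split:
  fixes A B :: "'a::comm_ring_1"
  shows "\<exists>C D. (A + B) ^ (k + l) = A ^ k * C + B ^ l * D"
proof (induction k arbitrary: l)
  case 0
  show ?case by (rule exI[of _ "(A + B) ^ l"], rule exI[of _ 0]) simp
next
  case (Suc k)
  note IH = this
  show ?case
  proof (induction l)
    case 0
    show ?case by (rule exI[of _ 0], rule exI[of _ "(A + B) ^ Suc k"]) simp
  next
    case (Suc l)
    obtain C D where 1: "(A + B) ^ (k + Suc l) = A ^ k * C + B ^ Suc l * D" using IH by blast
    obtain C' D' where 2: "(A + B) ^ (Suc k + l) = A ^ Suc k * C' + B ^ l * D'" using Suc by blast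
    have "(A + B) ^ (Suc k + Suc l) = A * (A + B) ^ (k + Suc l) + B * (A + B) ^ (Suc k + l)"
      by (simp add: algebra_simps)
    also have "\<dots> = A ^ Suc k * (C + B * C') + B ^ Suc l * (A * D + D')"
      unfolding 1 2 by (simp add: algebra_simps)
    finally show ?case by blast
  qed
qed

abbreviation eval_at :: "(nat \<Rightarrow> 'k::comm_ring_1) \<Rightarrow> 'k mpoly \<Rightarrow> 'k" where
  "eval_at \<equiv> insertion (\<lambda>x. x)"

lemma lin_form_nonzero:
  assumes "j < n" "c j \<noteq> (0 :: 'k::comm_ring_1)"
  shows "lin_form n c \<noteq> 0"
proof
  assume "lin_form n c = 0"
  then have "eval_at (\<lambda>i. if i = j then 1 else 0) (lin_form n c) = 0" by (simp add: insertion_0)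
  moreover have "eval_at (\<lambda>i. if i = j then 1 else 0) (lin_form n c) = c j"
    using assms(1) by (simp add: insertion_lin_form[OF comm_ring_hom_id] if_distrib[of "\<lambda>x. _ * x"] cong: if_cong)
  ultimately show False using assms(2) by simp
qed

text \<open>The variables \<open>mvar i\<close> and \<open>mvar (n + i)\<close> with \<open>i < n\<close> are the coordinates on the two factors
  of \<open>V \<times> V\<close>. The last assumption says that \<open>M - N\<close> has rank at least two.\<close>

locale separated_maps =
  fixes n r :: nat and a :: "'w \<Rightarrow> nat \<Rightarrow> nat \<Rightarrow> 'k::field" and W1 W2 :: "'w set" and F :: "nat \<Rightarrow> 'k mpoly"
  assumes ac: "alg_closed TYPE('k)" and fin: "finite W1" "finite W2" and r: "r \<le> n"
    and F: "\<And>i. i < r \<Longrightarrow> mvars (F i) \<subseteq> {..<n}"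
    and inv: "\<And>i M. i < r \<Longrightarrow> M \<in> W1 \<union> W2 \<Longrightarrow> insertion mconst (\<lambda>i. lin_form n (a M i)) (F i) = F i"
    and sep: "\<And>u v. (\<And>i. i < r \<Longrightarrow> eval_at u (F i) = eval_at v (F i)) \<Longrightarrow>
      \<exists>M\<in>W1 \<union> W2. \<forall>i<n. v i = (\<Sum>j<n. a M i j * u j)"
    and differ: "\<And>M N. M \<in> W1 \<Longrightarrow> N \<in> W2 \<Longrightarrow> \<exists>j<n. \<exists>i<n. a M i j - a N i j \<noteq> 0"
    and rank2: "\<And>M N c. M \<in> W1 \<Longrightarrow> N \<in> W2 \<Longrightarrow> \<exists>j<n. c j \<noteq> 0 \<Longrightarrow>
      \<exists>x. (\<Sum>j<n. c j * x j) = 0 \<and> (\<exists>i<n. (\<Sum>j<n. (a M i j - a N i j) * x j) \<noteq> 0)"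
begin

text \<open>Restriction of a polynomial on \<open>V \<times> V\<close> to the graph of
  \<open>M\<close>, with the first factor as parameter space.\<close>

definition graph :: "'w \<Rightarrow> 'k mpoly \<Rightarrow> 'k mpoly" where
  "graph M = insertion mconst (\<lambda>i. if n \<le> i \<and> i < n + n then lin_form n (a M (i - n)) else mvar i)"

lemma graph_hom: "comm_ring_hom (graph M)"
  unfolding graph_def by (rule insertion_hom[OF mconst_hom])

sublocale graph: comm_ring_hom "graph M" for M
  by (rule graph_hom)

lemma graph_mconst: "graph M (mconst c) = mconst c"
  by (simp add: graph_def insertion_mconst[OF mconst_hom])

lemma graph_mvar: "graph M (mvar i) = (if n \<le> i \<and> i < n + n then lin_form n (a M (i - n)) else mvar i)"
  by (simp add: graph_def insertion_mvar[OF mconst_hom])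

lemma graph_id:
  assumes "mvars f \<subseteq> {..<n}"
  shows "graph M f = f"
proof -
  have "graph M f = insertion mconst mvar f"
    unfolding graph_def by (rule insertion_cong) (use assms in auto)
  then show ?thesis by (simp add: insertion_mconst_mvar)
qed

lemma graph_lin_form: "graph M (lin_form n c) = lin_form n c"
  by (rule graph_id[OF mvars_lin_form])

text \<open>The padding by zeros from \<open>r\<close> to \<open>n\<close> makes the number of
  generators match the number of the polynomials \<open>H i\<close> below.\<close>

definition G :: "nat \<Rightarrow> 'k mpoly" where
  "G i = (if i < r then insertion mconst (\<lambda>j. mvar (n + j)) (F i) - F i else 0)"

lemma graph_G:
  assumes "M \<in> W1 \<union> W2"
  shows "graph M (G i) = 0"
proof (cases "i < r")
  case True
  have "graph M (insertion mconst (\<lambda>j. mvar (n + j)) (F i))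
      = insertion (\<lambda>c. graph M (mconst c)) (\<lambda>j. graph M (mvar (n + j))) (F i)"
    by (rule hom_insertion[OF graph_hom])
  also have "\<dots> = insertion mconst (\<lambda>j. graph M (mvar (n + j))) (F i)"
    by (simp add: graph_mconst)
  also have "\<dots> = insertion mconst (\<lambda>i. lin_form n (a M i)) (F i)"
    by (rule insertion_cong) (use F[OF True] in \<open>auto simp: graph_mvar\<close>)
  also have "\<dots> = F i" by (rule inv[OF True assms])
  finally show ?thesis using True by (simp add: G_def graph.hom_minus graph_id[OF F])
qed (simp add: G_def)

abbreviation I :: "'k mpoly set" where
  "I \<equiv> lincombs G {..<n}"

lemma graph_I:
  assumes "M \<in> W1 \<union> W2" "f \<in> I"
  shows "graph M f = 0"
  using assms(2) by (elim lincombsE) (simp add: graph.hom_sum graph.hom_mult graph_G[OF assms(1)])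

text \<open>By \<open>sep\<close>, a common zero of the \<open>G i\<close> lies on one of the
  graphs, so the Nullstellensatz applies to \<open>f\<close>.\<close>

lemma power_in_I:
  assumes van: "\<And>M. M \<in> W1 \<union> W2 \<Longrightarrow> graph M f = 0"
  shows "\<exists>N. f ^ N \<in> I"
proof (rule nullstellensatz[OF ac finite_lessThan])
  fix w assume w: "\<And>j. j \<in> {..<n} \<Longrightarrow> eval_at w (G j) = 0"
  interpret ev: comm_ring_hom "eval_at w" by (rule insertion_hom[OF comm_ring_hom_id])
  have "eval_at w (F i) = eval_at (\<lambda>j. w (n + j)) (F i)" if i: "i < r" for i
  proof -
    have "eval_at w (insertion mconst (\<lambda>j. mvar (n + j)) (F i)) = eval_at (\<lambda>j. w (n + j)) (F i)"
      by (simp add: hom_insertion[OF ev.comm_ring_hom_axioms] insertion_mconst[OF comm_ring_hom_id]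
          insertion_mvar[OF comm_ring_hom_id])
    moreover have "eval_at w (G i) = 0" using i r by (intro w) simp
    ultimately show ?thesis using i by (simp add: G_def ev.hom_minus)
  qed
  from sep[OF this] obtain M where M: "M \<in> W1 \<union> W2" "\<forall>i<n. w (n + i) = (\<Sum>j<n. a M i j * w j)"
    by blast
  have "eval_at w (graph M f) = insertion (\<lambda>c. eval_at w (mconst c))
      (\<lambda>i. eval_at w (if n \<le> i \<and> i < n + n then lin_form n (a M (i - n)) else mvar i)) f"
    unfolding graph_def by (rule hom_insertion[OF ev.comm_ring_hom_axioms])
  also have "(\<lambda>c. eval_at w (mconst c)) = (\<lambda>x. x)"
    by (simp add: insertion_mconst[OF comm_ring_hom_id])
  also have "(\<lambda>i. eval_at w (if n \<le> i \<and> i < n + n then lin_form n (a M (i - n)) else mvar i)) = w"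
  proof
    fix i
    show "eval_at w (if n \<le> i \<and> i < n + n then lin_form n (a M (i - n)) else mvar i) = w i"
    proof (cases "n \<le> i \<and> i < n + n")
      case True
      then have "i - n < n" by linarith
      with M(2) have "w (n + (i - n)) = (\<Sum>j<n. a M (i - n) j * w j)" by blast
      with True show ?thesis by (simp add: insertion_lin_form[OF comm_ring_hom_id])
    next
      case False
      then show ?thesis by (simp only: if_False insertion_mvar[OF comm_ring_hom_id])
    qed
  qed
  finally show "eval_at w f = 0" using van[OF M(1)] by simp
qed

section \<open>Sums of two functions vanishing on two families of graphs\<close>

definition splits :: "'w set \<Rightarrow> 'w set \<Rightarrow> 'k mpoly \<Rightarrow> bool" where
  "splits X Y f \<longleftrightarrow> (\<exists>A B. f = A + B \<and> (\<forall>N\<in>X. graph N A = 0) \<and> (\<forall>M\<in>Y. graph M B = 0))"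

lemma splitsI: "f = A + B \<Longrightarrow> (\<And>N. N \<in> X \<Longrightarrow> graph N A = 0) \<Longrightarrow> (\<And>M. M \<in> Y \<Longrightarrow> graph M B = 0) \<Longrightarrow> splits X Y f"
  by (auto simp: splits_def)

lemma splits_sym: "splits X Y f \<Longrightarrow> splits Y X f"
  unfolding splits_def by (metis add.commute)

text \<open>Among the four products only \<open>A * A'\<close> contains neither \<open>B\<close> nor
  \<open>B'\<close>, and it vanishes on the graphs over both \<open>X\<close> and
  \<open>X'\<close>.\<close>

lemma splits_mult:
  assumes "splits X Y f" "splits X' Y g"
  shows "splits (X \<union> X') Y (f * g)"
proof -
  obtain A B where 1: "f = A + B" "\<And>N. N \<in> X \<Longrightarrow> graph N A = 0" "\<And>M. M \<in> Y \<Longrightarrow> graph M B = 0"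
    using assms(1) by (auto simp: splits_def)
  obtain A' B' where 2: "g = A' + B'" "\<And>N. N \<in> X' \<Longrightarrow> graph N A' = 0" "\<And>M. M \<in> Y \<Longrightarrow> graph M B' = 0"
    using assms(2) by (auto simp: splits_def)
  show ?thesis
  proof (rule splitsI)
    show "f * g = A * A' + (A * B' + B * A' + B * B')" by (simp add: 1(1) 2(1) algebra_simps)
    show "graph N (A * A') = 0" if "N \<in> X \<union> X'" for N
      using that 1(2) 2(2) by (auto simp: graph.hom_mult)
    show "graph M (A * B' + B * A' + B * B') = 0" if "M \<in> Y" for M
      by (simp add: graph.hom_mult graph.hom_add 1(3)[OF that] 2(3)[OF that])
  qed
qed

lemma splits_prod:
  assumes "\<And>N. N \<in> X \<Longrightarrow> splits {N} Y (f N)" "finite X"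
  shows "splits X Y (prod f X)"
  using assms(2,1)
proof (induction X rule: finite_induct)
  case empty
  show ?case by (rule splitsI[of _ 1 0]) auto
next
  case (insert x X)
  then show ?case using splits_mult[of "{x}" Y "f x" X "prod f X"] by simp
qed

text \<open>Coefficients of \<open>\<Sum>i<n. \<theta> ^ i * ((M - N) x)_i\<close>, a linear form
  that vanishes wherever the graphs of \<open>M\<close> and \<open>N\<close> meet.\<close>

definition form_coeff :: "'k \<Rightarrow> 'w \<Rightarrow> 'w \<Rightarrow> nat \<Rightarrow> 'k" where
  "form_coeff \<theta> M N j = (\<Sum>i<n. \<theta> ^ i * (a M i j - a N i j))"

definition form_prod :: "'k \<Rightarrow> 'k mpoly" where
  "form_prod \<theta> = (\<Prod>N\<in>W2. \<Prod>M\<in>W1. lin_form n (form_coeff \<theta> M N))"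

text \<open>The form is the difference of \<open>L N\<close> and \<open>L M\<close>, where
  \<open>L M\<close> combines the equations \<open>y_i = (M x)_i\<close> of the graph of
  \<open>M\<close>; the coordinates on the second factor cancel.\<close>

lemma splits_form: "splits {N} {M} (lin_form n (form_coeff \<theta> M N))"
proof -
  define L where "L M = (\<Sum>i<n. mconst (\<theta> ^ i) * (mvar (n + i) - lin_form n (a M i)))" for M
  have L: "graph M (L M) = 0" for M
    by (simp add: L_def graph.hom_sum graph.hom_mult graph.hom_minus graph_mvar graph_lin_form)
  have "L N - L M = (\<Sum>i<n. mconst (\<theta> ^ i) * (lin_form n (a M i) - lin_form n (a N i)))"
    unfolding L_def sum_subtractf[symmetric] by (rule sum.cong) (simp_all add: algebra_simps)
  also have "\<dots> = (\<Sum>i<n. \<Sum>j<n. mconst (\<theta> ^ i * (a M i j - a N i j)) * mvar j)"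
    unfolding lin_form_def sum_subtractf[symmetric] sum_distrib_left
    by (intro sum.cong refl) (simp add: mconst.hom_mult mconst.hom_minus algebra_simps)
  also have "\<dots> = lin_form n (form_coeff \<theta> M N)"
    unfolding lin_form_def form_coeff_def mconst.hom_sum sum_distrib_right by (rule sum.swap)
  finally show ?thesis
    by (intro splitsI[of _ "L N" "- L M"]) (auto simp: L graph.hom_uminus)
qed

lemma splits_form_prod: "splits W2 W1 (form_prod \<theta>)"
  unfolding form_prod_def
  by (intro splits_prod fin splits_sym[OF splits_prod] splits_sym[OF splits_form])

text \<open>Monic in the coordinate \<open>mvar (n + i)\<close> and zero on every graph for
  \<open>i < n\<close>; suitable powers lie in \<open>I\<close> and supply \<open>n\<close> members
  of the regular sequences.\<close>

definition H :: "nat \<Rightarrow> 'k mpoly" where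
  "H i = (\<Prod>M\<in>W1 \<union> W2. mvar (n + i) - lin_form n (a M i))"

lemma H_power_in_I:
  assumes "i < n"
  shows "\<exists>N. H i ^ N \<in> I"
proof (rule power_in_I)
  fix M assume M: "M \<in> W1 \<union> W2"
  show "graph M (H i) = 0"
    unfolding H_def graph.hom_prod
    by (rule prod_zero) (use fin M assms in \<open>auto simp: graph.hom_minus graph_mvar graph_lin_form intro!: bexI[of _ M]\<close>)
qed

lemma mvars_H: "mvars (H i) \<subseteq> {..<n} \<union> {n + i}"
proof -
  have "mvars (mvar (n + i) - lin_form n (a M i)) \<subseteq> {..<n} \<union> {n + i}" for M
    using mvars_minus[of "mvar (n + i)" "lin_form n (a M i)"] mvars_lin_form[of n "a M i"] by auto
  then show ?thesis unfolding H_def by (intro order_trans[OF mvars_prod]) blast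
qed

lemma H_power_regular:
  assumes "\<And>j. j \<in> J \<Longrightarrow> n + i \<notin> mvars (g j)" and p: "H i ^ N * p \<in> lincombs g J"
  shows "p \<in> lincombs g J"
proof -
  have "p \<in> lincombs g J" if "H i * p \<in> lincombs g J" for p
    using _ that unfolding H_def
  proof (rule prod_regular)
    fix M p assume *: "(mvar (n + i) - lin_form n (a M i)) * p \<in> lincombs g J"
    show "p \<in> lincombs g J"
      by (rule monic_linear_regular[OF assms(1) _ *]) (use mvars_lin_form[of n "a M i"] in auto)
  qed
  from power_regular[OF this p] show ?thesis .
qed

text \<open>First \<open>\<theta>\<close> is chosen to make all factors nonzero. For each pair of
  factors, \<open>rank2\<close> yields a zero of the factor at \<open>\<theta>\<close> that the
  other difference of maps does not kill, and \<open>\<theta>'\<close> is chosen so that the factor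
  at \<open>\<theta>'\<close> is nonzero at that point. Then \<open>lin_form_prime\<close> applies
  to each pair.\<close>

lemma coprime_form_prods:
  obtains \<theta> \<theta>' where "form_prod \<theta> \<noteq> 0" "dvd_cancel (form_prod \<theta>) (form_prod \<theta>')"
proof -
  note inf = alg_closed_infinite[OF ac]
  have "\<forall>p\<in>W1 \<times> W2. \<exists>j. j < n \<and> (\<exists>i<n. a (fst p) i j - a (snd p) i j \<noteq> 0)"
  proof
    fix p assume "p \<in> W1 \<times> W2"
    then have "fst p \<in> W1" "snd p \<in> W2" by auto
    from differ[OF this] show "\<exists>j. j < n \<and> (\<exists>i<n. a (fst p) i j - a (snd p) i j \<noteq> 0)" by blast
  qed
  then obtain j where j: "\<And>p. p \<in> W1 \<times> W2 \<Longrightarrow> j p < n \<and> (\<exists>i<n. a (fst p) i (j p) - a (snd p) i (j p) \<noteq> 0)"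
    by metis
  obtain \<theta> where \<theta>: "\<And>p. p \<in> W1 \<times> W2 \<Longrightarrow> form_coeff \<theta> (fst p) (snd p) (j p) \<noteq> 0"
    unfolding form_coeff_def
    by (rule moment_curve_avoids[OF inf, of "W1 \<times> W2" n "\<lambda>p i. a (fst p) i (j p) - a (snd p) i (j p)"])
       (use fin j in blast)+
  define P where "P p q x \<longleftrightarrow> (\<Sum>j<n. form_coeff \<theta> (fst p) (snd p) j * x j) = 0 \<and>
      (\<exists>i<n. (\<Sum>j<n. (a (fst q) i j - a (snd q) i j) * x j) \<noteq> 0)" for p q x
  have P: "\<exists>x. P p q x" if p: "p \<in> W1 \<times> W2" and q: "q \<in> W1 \<times> W2" for p q
    unfolding P_def
  proof (rule rank2)
    show "\<exists>j<n. form_coeff \<theta> (fst p) (snd p) j \<noteq> 0" using j[OF p] \<theta>[OF p] by blast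
  qed (use q in auto)
  define x where "x p q = (SOME x. P p q x)" for p q
  have x: "P p q (x p q)" if "p \<in> W1 \<times> W2" "q \<in> W1 \<times> W2" for p q
    using someI_ex[OF P[OF that]] unfolding x_def .
  define d where "d pq i = (\<Sum>j<n. (a (fst (snd pq)) i j - a (snd (snd pq)) i j) * x (fst pq) (snd pq) j)" for pq i
  obtain \<theta>' where \<theta>': "\<And>pq. pq \<in> (W1 \<times> W2) \<times> (W1 \<times> W2) \<Longrightarrow> (\<Sum>i<n. \<theta>' ^ i * d pq i) \<noteq> 0"
  proof (rule moment_curve_avoids[OF inf, of "(W1 \<times> W2) \<times> (W1 \<times> W2)" n d])
    show "finite ((W1 \<times> W2) \<times> (W1 \<times> W2))" using fin by simp
    show "\<exists>i<n. d pq i \<noteq> 0" if "pq \<in> (W1 \<times> W2) \<times> (W1 \<times> W2)" for pq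
    proof -
      have "fst pq \<in> W1 \<times> W2" "snd pq \<in> W1 \<times> W2" using that by auto
      from x[OF this] show ?thesis unfolding d_def P_def by (rule conjunct2)
    qed
  qed blast
  have d_eq: "(\<Sum>i<n. \<theta>' ^ i * d (p, q) i) = (\<Sum>j<n. form_coeff \<theta>' (fst q) (snd q) j * x p q j)" for p q
  proof -
    have "(\<Sum>i<n. \<theta>' ^ i * d (p, q) i)
        = (\<Sum>i<n. \<Sum>j<n. \<theta>' ^ i * (a (fst q) i j - a (snd q) i j) * x p q j)"
      by (simp add: d_def sum_distrib_left mult.assoc)
    also have "\<dots> = (\<Sum>j<n. \<Sum>i<n. \<theta>' ^ i * (a (fst q) i j - a (snd q) i j) * x p q j)"
      by (rule sum.swap)
    finally show ?thesis by (simp add: form_coeff_def sum_distrib_right)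
  qed
  have cancel: "dvd_cancel (lin_form n (form_coeff \<theta> M N)) (lin_form n (form_coeff \<theta>' M' N'))"
    if "M \<in> W1" "N \<in> W2" "M' \<in> W1" "N' \<in> W2" for M N M' N'
  proof -
    have p: "(M, N) \<in> W1 \<times> W2" and q: "(M', N') \<in> W1 \<times> W2" using that by auto
    have "(\<Sum>j<n. form_coeff \<theta>' M' N' j * x (M, N) (M', N') j) \<noteq> 0"
      using \<theta>'[of "((M, N), (M', N'))"] p q d_eq[of "(M, N)" "(M', N')"] by simp
    moreover have "(\<Sum>j<n. form_coeff \<theta> M N j * x (M, N) (M', N') j) = 0"
      using x[OF p q] by (simp add: P_def)
    moreover have "j (M, N) < n" "form_coeff \<theta> M N (j (M, N)) \<noteq> 0"
      using j[OF p] \<theta>[OF p] by simp_all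
    ultimately show ?thesis unfolding dvd_cancel_def
      by (intro allI impI) (rule lin_form_prime)
  qed
  have "dvd_cancel (form_prod \<theta>) (form_prod \<theta>')"
    unfolding form_prod_def
    by (intro dvd_cancel_prod_left dvd_cancel_prod_right cancel)
  moreover have "form_prod \<theta> \<noteq> 0"
  proof -
    have "lin_form n (form_coeff \<theta> M N) \<noteq> 0" if "M \<in> W1" "N \<in> W2" for M N
      by (rule lin_form_nonzero[of "j (M, N)"]) (use j[of "(M, N)"] \<theta>[of "(M, N)"] that in auto)
    then show ?thesis unfolding form_prod_def using fin by (simp add: prod_zero_iff)
  qed
  ultimately show ?thesis using that by blast
qed

lemma mvars_form_prod: "mvars (form_prod \<theta>) \<subseteq> {..<n}"
  unfolding form_prod_def
  by (intro order_trans[OF mvars_prod] UN_least mvars_lin_form)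

end

section \<open>The connectedness argument\<close>

lemma power_in_lincombs_mono:
  assumes "x ^ N \<in> lincombs g J" "N \<le> k"
  shows "x ^ k \<in> lincombs g J"
proof -
  have "x ^ k = x ^ (k - N) * x ^ N" using assms(2) by (simp add: power_add[symmetric])
  then show ?thesis using lincombs_mult[OF assms(1)] by simp
qed

lemma lincombs_empty: "x \<in> lincombs h {} \<Longrightarrow> x = 0"
  by (elim lincombsE) simp

context separated_maps
begin

lemma no_separation:
  assumes "W1 \<noteq> {}" "W2 \<noteq> {}"
  shows False
proof -
  obtain \<theta> \<theta>' where s0: "form_prod \<theta> \<noteq> 0" and cop: "dvd_cancel (form_prod \<theta>) (form_prod \<theta>')"
    by (rule coprime_form_prods)
  obtain A B where AB: "form_prod \<theta> = A + B" "\<And>N. N \<in> W2 \<Longrightarrow> graph N A = 0" "\<And>M. M \<in> W1 \<Longrightarrow> graph M B = 0"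
    using splits_form_prod[of \<theta>] by (auto simp: splits_def)
  obtain A' B' where AB': "form_prod \<theta>' = A' + B'" "\<And>N. N \<in> W2 \<Longrightarrow> graph N A' = 0" "\<And>M. M \<in> W1 \<Longrightarrow> graph M B' = 0"
    using splits_form_prod[of \<theta>'] by (auto simp: splits_def)
  have van: "\<exists>N. (X * Y) ^ N \<in> I" if "\<And>N. N \<in> W2 \<Longrightarrow> graph N X = 0" "\<And>M. M \<in> W1 \<Longrightarrow> graph M Y = 0" for X Y
    by (rule power_in_I) (use that in \<open>auto simp: graph.hom_mult\<close>)
  obtain N1 where N1: "(A * B) ^ N1 \<in> I" using van[OF AB(2,3)] by blast
  obtain N2 where N2: "(A * B') ^ N2 \<in> I" using van[OF AB(2) AB'(3)] by blast
  obtain N3 where N3: "(A' * B) ^ N3 \<in> I" using van[OF AB'(2) AB(3)] by blast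
  \<comment> \<open>Large enough for all three products, and positive, so that \<open>A ^ k\<close>
    and \<open>B ^ k\<close> vanish where \<open>A\<close> and \<open>B\<close> do.\<close>
  define k where "k = Suc (N1 + N2 + N3)"
  obtain C D where CD: "(A + B) ^ (k + k) = A ^ k * C + B ^ k * D" using power_add_split by blast
  obtain C' D' where CD': "(A' + B') ^ (k + k) = A' ^ k * C' + B' ^ k * D'" using power_add_split by blast
  define s t where "s = form_prod \<theta> ^ (k + k)" and "t = form_prod \<theta>' ^ (k + k)"
  define A1 B1 A2 B2 where "A1 = A ^ k * C" and "B1 = B ^ k * D" and "A2 = A' ^ k * C'" and "B2 = B' ^ k * D'"
  have s: "s = A1 + B1" and t: "t = A2 + B2"
    by (simp_all add: s_def t_def AB(1) AB'(1) CD CD' A1_def B1_def A2_def B2_def)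
  have inI: "(X ^ k * Z) * (Y ^ k * Z') \<in> I" if "(X * Y) ^ N \<in> I" "N \<le> k" for X Y Z Z' N
  proof -
    have "(Z * Z') * (X * Y) ^ k \<in> I" by (rule lincombs_mult[OF power_in_lincombs_mono[OF that]])
    then show ?thesis by (simp add: power_mult_distrib mult_ac)
  qed
  have A1B1: "A1 * B1 \<in> I" and A1B2: "A1 * B2 \<in> I" and A2B1: "A2 * B1 \<in> I"
    unfolding A1_def A2_def B1_def B2_def
    by (rule inI[OF N1] inI[OF N2] inI[OF N3], simp add: k_def)+
  have "s \<noteq> 0" using s0 by (simp add: s_def)
  have cop': "dvd_cancel s t" unfolding s_def t_def by (rule dvd_cancel_power[OF cop])
  have mvars_s: "mvars s \<subseteq> {..<n}" and mvars_t: "mvars t \<subseteq> {..<n}"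
    unfolding s_def t_def by (rule order_trans[OF mvars_power mvars_form_prod])+
  have "\<forall>i. \<exists>N. i < n \<longrightarrow> H i ^ N \<in> I" using H_power_in_I by blast
  then obtain e where e: "\<And>i. i < n \<Longrightarrow> H i ^ e i \<in> I" by metis
  define H' where "H' i = H i ^ e i" for i
  have H'I: "H' i \<in> I" if "i < n" for i using e[OF that] by (simp add: H'_def)
  \<comment> \<open>No earlier \<open>H' j\<close> contains the variable in which
    \<open>H' i\<close> is monic, so \<open>H' i\<close> can be cancelled modulo its
    predecessors.\<close>
  have mvars_H': "n + i \<notin> mvars (H' j)" if "j < i" for i j
    using order_trans[OF mvars_power mvars_H, of j "e j"] that unfolding H'_def by auto
  define g where "g j = (if j < n then G j else if j = n then s else t)" for j
  have gI: "lincombs g {..<n} = I"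
    by (rule lincombs_cong) (simp add: g_def)
  have gn: "g n = s" "g (Suc n) = t" by (simp_all add: g_def)
  have H'_in: "H' i \<in> lincombs g {..<m}" if "i < n" "n \<le> m" for i m
    using H'I[OF that(1)] lincombs_mono[of "{..<m}" "{..<n}" g] that(2) unfolding gI by auto
  \<comment> \<open>The sequence \<open>s, H' 0, ..., H' (n - 1)\<close> is regular and lies in the
    ideal of the \<open>n + 1\<close> generators \<open>G 0, ..., G (n - 1), s\<close>, so in a
    relation among these the coefficient of \<open>s\<close> lies in \<open>I\<close>.\<close>
  have s_reg: "p \<in> I" if sp: "s * p \<in> I" for p
  proof -
    define h where "h j = (if j = 0 then s else H' (j - 1))" for j
    have gen: "h j \<in> lincombs g {..<Suc n}" if "j < Suc n" for j
      using that H'_in[of "j - 1" "Suc n"] lincombs_gen[of "{..<Suc n}" n g] by (auto simp: h_def gn)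
    have reg: "q \<in> lincombs h {..<j}" if "j < Suc n" and q: "h j * q \<in> lincombs h {..<j}" for j q
    proof (cases "j = 0")
      case True
      with q have "s * q = 0" by (intro lincombs_empty) (simp add: h_def)
      with \<open>s \<noteq> 0\<close> show ?thesis by simp
    next
      case False
      show ?thesis
      proof (rule H_power_regular)
        show "H (j - 1) ^ e (j - 1) * q \<in> lincombs h {..<j}" using q False by (simp add: h_def H'_def)
        show "n + (j - 1) \<notin> mvars (h i)" if "i \<in> {..<j}" for i
          using mvars_H'[of "i - 1" "j - 1"] mvars_s that unfolding h_def by auto
      qed
    qed
    obtain c where c: "s * p = (\<Sum>j<n. c j * G j)" using sp by (elim lincombsE)
    define c' where "c' = (\<lambda>j. - c j)(n := p)"
    have "(\<Sum>j<Suc n. c' j * g j) = (\<Sum>j<n. - (c j * G j)) + p * s"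
      by (simp add: c'_def g_def)
    also have "\<dots> = 0" by (simp add: sum_negf c[symmetric] mult.commute)
    finally have "c' n \<in> lincombs g ({..<Suc n} - {n})"
      by (intro relation_coefficient_in_ideal[OF gen reg]) auto
    moreover have "{..<Suc n} - {n} = {..<n}" by auto
    ultimately show ?thesis by (simp add: c'_def gI)
  qed
  \<comment> \<open>The same with \<open>t\<close> added: \<open>A1\<close> is the coefficient of
    \<open>t\<close> in a relation among the \<open>G j\<close>, \<open>s\<close> and
    \<open>t\<close>, hence lies in the ideal of the others.\<close>
  have "\<exists>\<epsilon>. A1 - \<epsilon> * s \<in> I"
  proof -
    define h where "h j = (if j = 0 then s else if j = 1 then t else H' (j - 2))" for j
    let ?m = "Suc (Suc n)"
    have gen: "h j \<in> lincombs g {..<?m}" if "j < ?m" for j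
      using that H'_in[of "j - 2" ?m] lincombs_gen[of "{..<?m}" n g] lincombs_gen[of "{..<?m}" "Suc n" g]
      by (auto simp: h_def gn)
    have reg: "q \<in> lincombs h {..<j}" if "j < ?m" and q: "h j * q \<in> lincombs h {..<j}" for j q
    proof -
      consider "j = 0" | "j = 1" | "j \<ge> 2" by linarith
      then show ?thesis
      proof cases
        case 1
        with q have "s * q = 0" by (intro lincombs_empty) (simp add: h_def)
        with \<open>s \<noteq> 0\<close> show ?thesis by simp
      next
        case 2
        then have "t * q \<in> lincombs h {..<Suc 0}" using q by (simp add: h_def)
        from lincombs_Suc[OF this] obtain b where "t * q - b * h 0 \<in> lincombs h {..<0}" by blast
        then have "t * q - b * s = 0" by (intro lincombs_empty) (simp add: h_def)
        then have "s dvd t * q" by simp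
        then have "s dvd q" by (rule dvd_cancelD[OF cop'])
        then obtain q' where "q = s * q'" by (elim dvdE)
        then have "q = q' * h 0" by (simp add: h_def mult.commute)
        then show ?thesis using 2 by (simp add: lincombs_mult lincombs_gen)
      next
        case 3
        show ?thesis
        proof (rule H_power_regular)
          show "H (j - 2) ^ e (j - 2) * q \<in> lincombs h {..<j}" using q 3 by (simp add: h_def H'_def)
          show "n + (j - 2) \<notin> mvars (h i)" if "i \<in> {..<j}" for i
            using mvars_H'[of "i - 2" "j - 2"] mvars_s mvars_t that unfolding h_def by auto
        qed
      qed
    qed
    have "A1 * B2 - A2 * B1 \<in> I" by (rule lincombs_diff[OF A1B2 A2B1])
    also have "A1 * B2 - A2 * B1 = A1 * t - A2 * s" by (simp add: s t algebra_simps)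
    finally obtain c where c: "A1 * t - A2 * s = (\<Sum>j<n. c j * G j)" by (elim lincombsE)
    define c' where "c' = (\<lambda>j. - c j)(n := - A2, Suc n := A1)"
    have "(\<Sum>j<?m. c' j * g j) = (\<Sum>j<n. - (c j * G j)) - A2 * s + A1 * t"
      by (simp add: c'_def g_def)
    also have "\<dots> = 0" by (simp add: sum_negf c[symmetric])
    finally have "c' (Suc n) \<in> lincombs g ({..<?m} - {Suc n})"
      by (intro relation_coefficient_in_ideal[OF gen reg]) auto
    moreover have "{..<?m} - {Suc n} = {..<Suc n}" by auto
    ultimately have "A1 \<in> lincombs g {..<Suc n}" by (simp add: c'_def)
    from lincombs_Suc[OF this] show ?thesis by (simp add: gI gn)
  qed
  then obtain \<epsilon> where \<epsilon>: "A1 - \<epsilon> * s \<in> I" by blast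
  define x where "x = A1 - \<epsilon> * s"
  \<comment> \<open>Modulo \<open>I\<close>, \<open>A1\<close> is \<open>\<epsilon> * s\<close> and
    \<open>B1\<close> is \<open>s - A1\<close>, so \<open>A1 * B1 \<in> I\<close> reads
    \<open>s ^ 2 * \<epsilon> * (1 - \<epsilon>) \<in> I\<close>; cancelling \<open>s\<close> twice
    makes \<open>\<epsilon>\<close> idempotent modulo \<open>I\<close>.\<close>
  have "x * (s - 2 * \<epsilon> * s - x) - A1 * B1 \<in> I"
  proof (rule lincombs_diff[OF _ A1B1])
    show "x * (s - 2 * \<epsilon> * s - x) \<in> I"
      using lincombs_mult[OF \<epsilon>, of "s - 2 * \<epsilon> * s - x"] by (simp add: x_def mult.commute)
  qed
  also have "x * (s - 2 * \<epsilon> * s - x) - A1 * B1 = s * (s * (\<epsilon> * (\<epsilon> - 1)))"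
  proof -
    have "B1 = s - A1" by (simp add: s)
    then show ?thesis by (simp add: x_def) (simp add: algebra_simps)
  qed
  finally have idem: "\<epsilon> * (\<epsilon> - 1) \<in> I" by (rule s_reg[OF s_reg])
  have graph_s: "graph M s = s" for M by (rule graph_id[OF mvars_s])
  have graph_A1: "graph M A1 = graph M \<epsilon> * s" if "M \<in> W1 \<union> W2" for M
    using graph_I[OF that \<epsilon>] by (simp add: graph.hom_minus graph.hom_mult graph_s)
  \<comment> \<open>The restriction to a graph lies in a domain, whose only idempotents are
    \<open>0\<close> and \<open>1\<close>.\<close>
  have const: "graph M \<epsilon> = 0 \<or> graph M \<epsilon> = 1" if "M \<in> W1 \<union> W2" for M
    using graph_I[OF that idem] by (simp add: graph.hom_minus graph.hom_mult)
  \<comment> \<open>All graphs of linear maps pass through the origin of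
    \<open>V \<times> V\<close>, so the restrictions of \<open>\<epsilon>\<close> have a common
    value there.\<close>
  have ev0: "eval_at (\<lambda>_. 0) (graph M \<epsilon>) = eval_at (\<lambda>_. 0) \<epsilon>" for M
  proof -
    have ev: "comm_ring_hom (eval_at (\<lambda>_. 0 :: 'k))" by (rule insertion_hom[OF comm_ring_hom_id])
    have "eval_at (\<lambda>_. 0) (graph M \<epsilon>) = insertion (\<lambda>c. eval_at (\<lambda>_. 0) (mconst c))
        (\<lambda>i. eval_at (\<lambda>_. 0) (if n \<le> i \<and> i < n + n then lin_form n (a M (i - n)) else mvar i)) \<epsilon>"
      unfolding graph_def by (rule hom_insertion[OF ev])
    also have "(\<lambda>c. eval_at (\<lambda>_. 0 :: 'k) (mconst c)) = (\<lambda>x. x)"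
      by (simp add: insertion_mconst[OF comm_ring_hom_id])
    also have "(\<lambda>i. eval_at (\<lambda>_. 0) (if n \<le> i \<and> i < n + n then lin_form n (a M (i - n)) else mvar i)) = (\<lambda>_. 0)"
      by (rule ext) (simp add: insertion_lin_form[OF comm_ring_hom_id] insertion_mvar[OF comm_ring_hom_id])
    finally show ?thesis .
  qed
  obtain M N where M: "M \<in> W1" and N: "N \<in> W2" using assms by blast
  \<comment> \<open>On the graph of \<open>M\<close> in \<open>W1\<close> all of \<open>s\<close>
    comes from \<open>A1\<close>, on that of \<open>N\<close> in \<open>W2\<close> nothing does;
    hence \<open>\<epsilon>\<close> is \<open>1\<close> on the former and \<open>0\<close> on the
    latter.\<close>
  have "graph M B1 = 0" using AB(3)[OF M] by (simp add: B1_def graph.hom_mult graph.hom_power k_def)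
  then have "graph M A1 = s" using graph_s[of M] by (simp add: s graph.hom_add)
  then have "graph M \<epsilon> \<noteq> 0" using graph_A1[of M] M \<open>s \<noteq> 0\<close> by auto
  then have "graph M \<epsilon> = 1" using const[of M] M by blast
  moreover have "graph N A1 = 0" using AB(2)[OF N] by (simp add: A1_def graph.hom_mult graph.hom_power k_def)
  then have "graph N \<epsilon> = 0" using graph_A1[of N] N \<open>s \<noteq> 0\<close> by simp
  ultimately show False
    using ev0[of M] ev0[of N] by (simp add: insertion_0 insertion_1[OF comm_ring_hom_id])
qed

end

section \<open>Generation by reflections\<close>

lemma lin_rep_image_bij:
  assumes G: "group G" and \<rho>: "lin_rep G n \<rho>" and N: "N \<in> \<rho> ` carrier G"
  shows "bij_betw (\<lambda>M. M * N) (\<rho> ` carrier G) (\<rho> ` carrier G)"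
proof -
  interpret group G by fact
  obtain \<tau> where \<tau>: "\<tau> \<in> carrier G" "N = \<rho> \<tau>" using N by blast
  have mult: "\<rho> (\<sigma> \<otimes>\<^bsub>G\<^esub> \<sigma>') = \<rho> \<sigma> * \<rho> \<sigma>'" if "\<sigma> \<in> carrier G" "\<sigma>' \<in> carrier G" for \<sigma> \<sigma>'
    using \<rho> that by (simp add: lin_rep_def)
  show ?thesis
  proof (rule bij_betw_byWitness[where f' = "\<lambda>M. M * \<rho> (inv\<^bsub>G\<^esub> \<tau>)"])
    show "\<forall>M\<in>\<rho> ` carrier G. M * N * \<rho> (inv\<^bsub>G\<^esub> \<tau>) = M"
      using \<tau> by (auto simp: mult[symmetric] m_assoc)
    show "\<forall>M\<in>\<rho> ` carrier G. M * \<rho> (inv\<^bsub>G\<^esub> \<tau>) * N = M"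
      using \<tau> by (auto simp: mult[symmetric] m_assoc)
    show "(\<lambda>M. M * N) ` \<rho> ` carrier G \<subseteq> \<rho> ` carrier G"
      using \<tau> by (auto simp: mult[symmetric])
    show "(\<lambda>M. M * \<rho> (inv\<^bsub>G\<^esub> \<tau>)) ` \<rho> ` carrier G \<subseteq> \<rho> ` carrier G"
      using \<tau> by (auto simp: mult[symmetric])
  qed
qed

lemma poly_act_mat_forms: "poly_act G n \<rho> \<sigma> f = insertion mconst (mat_forms n (\<rho> (inv\<^bsub>G\<^esub> \<sigma>))) f"
  by (simp add: poly_act_def msubst_insertion mat_forms_def[abs_def] lin_form_def)

text \<open>Inversion permutes the group, so the inverse in the action on polynomials drops out once
  all matrices of the image are considered.\<close>

lemma invariant_ring_image:
  assumes "group G"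
  shows "invariant_ring G n \<rho>
    = {f \<in> coord_ring n. \<forall>N\<in>\<rho> ` carrier G. insertion mconst (mat_forms n N) f = f}"
proof -
  interpret group G by fact
  have "(\<lambda>\<sigma>. inv\<^bsub>G\<^esub> \<sigma>) ` carrier G = carrier G"
    by (rule bij_betw_imp_surj_on[OF bij_betw_byWitness[where f' = "\<lambda>\<sigma>. inv\<^bsub>G\<^esub> \<sigma>"]]) auto
  then have image: "\<rho> ` carrier G = (\<lambda>\<sigma>. \<rho> (inv\<^bsub>G\<^esub> \<sigma>)) ` carrier G"
    by (metis image_image)
  show ?thesis
    unfolding image invariant_ring_def poly_act_mat_forms by simp
qed

text \<open>If \<open>D\<close> vanishes over the larger field on the hyperplane defined by
  \<open>c\<close>, its nonzero row \<open>i0\<close> is proportional to \<open>c\<close>. That row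
  has entries in the smaller field and so defines the hyperplane already there.\<close>

lemma hyperplane_descent:
  fixes \<iota> :: "'k::field \<Rightarrow> 'K::field" and D :: "nat \<Rightarrow> nat \<Rightarrow> 'k"
  assumes \<iota>: "comm_ring_hom \<iota>" "inj \<iota>"
    and i0: "i0 < n" "j0 < n" "D i0 j0 \<noteq> 0"
    and ker: "\<And>x i. (\<Sum>j<n. c j * x j) = 0 \<Longrightarrow> i < n \<Longrightarrow> (\<Sum>j<n. \<iota> (D i j) * x j) = 0"
    and u: "(\<Sum>j<n. D i0 j * u j) = 0" and i: "i < n"
  shows "(\<Sum>j<n. D i j * u j) = 0"
proof -
  interpret comm_ring_hom \<iota> by (rule \<iota>(1))
  have iota_0: "\<iota> y = 0 \<longleftrightarrow> y = 0" for y using inj_eq[OF \<iota>(2), of y 0] by simp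
  have cross: "c j * \<iota> (D i0 j') = c j' * \<iota> (D i0 j)" if "j < n" "j' < n" for j j'
  proof (cases "j = j'")
    case False
    \<comment> \<open>A vector supported on \<open>j\<close> and \<open>j'\<close> on which
      \<open>c\<close> vanishes; row \<open>i0\<close> vanishes on it too, which is the
      proportionality.\<close>
    define x where "x l = (if l = j' then c j else 0) - (if l = j then c j' else 0)" for l
    have sum_x: "(\<Sum>l<n. f l * x l) = f j' * c j - f j * c j'" for f
      using that by (simp add: x_def right_diff_distrib sum_subtractf if_distrib[of "\<lambda>y. f _ * y"] cong: if_cong)
    have "(\<Sum>l<n. \<iota> (D i0 l) * x l) = 0" by (rule ker[OF _ i0(1)]) (simp only: sum_x mult.commute[of "c j'"] diff_self)
    then have "\<iota> (D i0 j') * c j - \<iota> (D i0 j) * c j' = 0" by (simp only: sum_x)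
    then show ?thesis by (simp add: mult.commute)
  qed simp
  have "\<iota> (D i0 j0) * (\<Sum>j<n. c j * \<iota> (u j)) = (\<Sum>j<n. (c j * \<iota> (D i0 j0)) * \<iota> (u j))"
    by (simp add: sum_distrib_left mult_ac)
  also have "\<dots> = (\<Sum>j<n. (c j0 * \<iota> (D i0 j)) * \<iota> (u j))"
    by (rule sum.cong) (simp_all add: cross i0(2))
  also have "\<dots> = c j0 * \<iota> (\<Sum>j<n. D i0 j * u j)"
    by (simp add: hom_sum hom_mult sum_distrib_left mult.assoc)
  finally have "(\<Sum>j<n. c j * \<iota> (u j)) = 0" using u i0(3) iota_0 by simp
  then have "(\<Sum>j<n. \<iota> (D i j) * \<iota> (u j)) = 0" by (rule ker[OF _ i])
  then have "\<iota> (\<Sum>j<n. D i j * u j) = 0" by (simp add: hom_sum hom_mult)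
  then show ?thesis by (simp add: iota_0)
qed

theorem theorem1p1:
  fixes G :: "('g, 'b) monoid_scheme" and n :: nat and \<rho> :: "'g \<Rightarrow> 'k::field mat"
    and \<iota> :: "'k \<Rightarrow> 'K::field" and A :: "'k mpoly set"
  assumes "group G" and "finite (carrier G)"
    and "lin_rep G n \<rho>"
    and "is_alg_closure \<iota>"
    and "geom_separating \<iota> G n \<rho> A"
    and "is_polynomial_ring A"
  shows "generated_by_reflections G n \<rho>"
proof (rule ccontr)
  assume not_gen: "\<not> ?thesis"
  interpret group G by fact
  define R where "R = {\<sigma>. is_reflection G n \<rho> \<sigma>}"
  have R: "R \<subseteq> carrier G" by (auto simp: R_def is_reflection_def)
  interpret Hg: subgroup "generate G R" G by (rule generate_is_subgroup[OF R])
  \<comment> \<open>The graphs depend only on the matrices, and \<open>\<rho>\<close> may have a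
    kernel; so the group and its reflection subgroup are replaced by their images.\<close>
  define W where "W = \<rho> ` carrier G"
  define W1 where "W1 = \<rho> ` generate G R"
  define W2 where "W2 = W - W1"
  have W1W: "W1 \<subseteq> W" using Hg.subset by (auto simp: W1_def W_def)
  then have W12: "W1 \<union> W2 = W" by (auto simp: W2_def)
  have finW: "finite W" using assms(2) by (simp add: W_def)
  have rho: "\<And>\<sigma>. \<sigma> \<in> carrier G \<Longrightarrow> \<rho> \<sigma> \<in> carrier_mat n n" "\<rho> \<one>\<^bsub>G\<^esub> = 1\<^sub>m n"
    "\<And>\<sigma> \<tau>. \<sigma> \<in> carrier G \<Longrightarrow> \<tau> \<in> carrier G \<Longrightarrow> \<rho> (\<sigma> \<otimes>\<^bsub>G\<^esub> \<tau>) = \<rho> \<sigma> * \<rho> \<tau>"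
    using assms(3) by (simp_all add: lin_rep_def)
  have Wc: "W \<subseteq> carrier_mat n n" using rho(1) by (auto simp: W_def)
  have W1_ne: "W1 \<noteq> {}" using Hg.one_closed unfolding W1_def by blast
  have "W \<noteq> W1"
    using not_gen by (simp add: generated_by_reflections_def W_def W1_def R_def)
  then have W2_ne: "W2 \<noteq> {}" using W1W by (auto simp: W2_def)
  have \<iota>_add: "\<iota> (x + y) = \<iota> x + \<iota> y" and \<iota>_mult: "\<iota> (x * y) = \<iota> x * \<iota> y" for x y
    using assms(4) by (simp_all add: is_alg_closure_def)
  have \<iota>_inj: "inj \<iota>" and \<iota>_1: "\<iota> 1 = 1" and ac: "alg_closed TYPE('K)"
    using assms(4) by (simp_all add: is_alg_closure_def alg_closed_def)
  have "\<iota> 0 + \<iota> 0 = \<iota> 0 + 0" by (simp only: \<iota>_add[symmetric] add_0_right)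
  then have \<iota>_0: "\<iota> 0 = 0" by (rule add_left_imp_eq)
  have \<iota>: "comm_ring_hom \<iota>" by unfold_locales (simp_all add: \<iota>_add \<iota>_mult \<iota>_0 \<iota>_1)
  interpret \<iota>: comm_ring_hom \<iota> by (rule \<iota>)
  define Inv where "Inv = invariant_ring G n \<rho>"
  have Inv_eq: "Inv = {f \<in> coord_ring n. \<forall>N\<in>W. insertion mconst (mat_forms n N) f = f}"
    unfolding Inv_def W_def by (rule invariant_ring_image) (rule assms(1))
  have AInv: "A \<subseteq> Inv" using assms(5) by (simp add: geom_separating_def Inv_def)
  obtain r F where F: "\<And>i. i < r \<Longrightarrow> F i \<in> A" and A: "A = {msubst F p | p. p \<in> coord_ring r}"
    and indep: "\<And>p. p \<in> coord_ring r \<Longrightarrow> msubst F p = 0 \<Longrightarrow> p = 0"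
    using assms(6) unfolding is_polynomial_ring_def by blast
  have F_Inv: "F i \<in> Inv" if "i < r" for i using F[OF that] AInv by blast
  have F_coord: "F i \<in> coord_ring n" if "i < r" for i using F_Inv[OF that] by (simp add: Inv_eq)
  have rn: "r \<le> n" by (rule algebraically_independent_card_le[OF F_coord indep])
  define a where "a M i j = \<iota> (M $$ (i, j))" for M i j
  have \<iota>c: "comm_ring_hom (\<lambda>c. mconst (\<iota> c))" by (rule comm_ring_hom_comp[OF mconst_hom \<iota>])
  \<comment> \<open>The generators with their coefficients moved to the algebraic closure, where the
    Nullstellensatz holds.\<close>
  define F' where "F' i = insertion (\<lambda>c. mconst (\<iota> c)) mvar (F i)" for i
  have eval_F': "eval_at u (F' i) = insertion \<iota> u (F i)" for u i
    unfolding F'_def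
    by (simp add: hom_insertion[OF insertion_hom[OF comm_ring_hom_id]]
        insertion_mconst[OF comm_ring_hom_id] insertion_mvar[OF comm_ring_hom_id])
  have vec_eq: "meval \<iota> f (vec n u) = insertion \<iota> u f" if "f \<in> coord_ring n" for f u
    unfolding meval_insertion
    by (rule insertion_cong) (use that in \<open>auto simp: coord_ring_def\<close>)
  have "separated_maps n r a W1 W2 F'"
  proof
    show "alg_closed TYPE('K)" by (rule ac)
    show "finite W1" "finite W2" using finW W1W by (auto simp: W2_def intro: finite_subset)
    show "r \<le> n" by (rule rn)
    show "mvars (F' i) \<subseteq> {..<n}" if "i < r" for i
      unfolding F'_def by (rule mvars_insertion) (use F_coord[OF that] in \<open>auto simp: coord_ring_def\<close>)
    show "insertion mconst (\<lambda>i. lin_form n (a M i)) (F' i) = F' i" if "i < r" "M \<in> W1 \<union> W2" for i M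
    proof -
      let ?f = "F i"
      have "insertion mconst (\<lambda>i. lin_form n (a M i)) (F' i)
          = insertion (\<lambda>c. mconst (\<iota> c)) (\<lambda>i. lin_form n (a M i)) ?f"
        unfolding F'_def hom_insertion[OF insertion_hom[OF mconst_hom]]
        by (simp add: insertion_mconst[OF mconst_hom] insertion_mvar[OF mconst_hom])
      also have "\<dots> = insertion (\<lambda>c. mconst (\<iota> c)) mvar (insertion mconst (mat_forms n M) ?f)"
      proof -
        have "insertion (\<lambda>c. mconst (\<iota> c)) mvar (mat_forms n M i) = lin_form n (a M i)" for i
          unfolding mat_forms_def insertion_lin_form[OF \<iota>c] by (simp add: lin_form_def a_def)
        then show ?thesis
          unfolding hom_insertion[OF insertion_hom[OF \<iota>c]]
          by (simp add: insertion_mconst[OF \<iota>c])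
      qed
      also have "insertion mconst (mat_forms n M) ?f = ?f"
        using F_Inv[OF that(1)] that(2) by (simp add: Inv_eq W12)
      finally show ?thesis by (simp add: F'_def)
    qed
    show "\<exists>M\<in>W1 \<union> W2. \<forall>i<n. v i = (\<Sum>j<n. a M i j * u j)"
      if uv: "\<And>i. i < r \<Longrightarrow> eval_at u (F' i) = eval_at v (F' i)" for u v
    proof -
      \<comment> \<open>Values of the \<open>F i\<close> determine those of all of \<open>A\<close>,
        the separating property passes this on to all invariants, and invariants over the small
        field separate the orbits of \<open>W\<close> over the closure.\<close>
      have "insertion \<iota> u h = insertion \<iota> v h" if h: "h \<in> A" for h
      proof -
        obtain p where p: "h = insertion mconst F p" "p \<in> coord_ring r"
          using h unfolding A msubst_insertion by blast
        have "insertion \<iota> w h = insertion \<iota> (\<lambda>i. insertion \<iota> w (F i)) p" for w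
          unfolding p(1) by (simp add: hom_insertion[OF insertion_hom[OF \<iota>]] insertion_mconst[OF \<iota>])
        moreover have "insertion \<iota> (\<lambda>i. insertion \<iota> u (F i)) p = insertion \<iota> (\<lambda>i. insertion \<iota> v (F i)) p"
        proof (rule insertion_cong)
          fix i assume "i \<in> mvars p"
          with p(2) have "i < r" by (auto simp: coord_ring_def)
          from uv[OF this] show "insertion \<iota> u (F i) = insertion \<iota> v (F i)" by (simp only: eval_F')
        qed
        ultimately show ?thesis by simp
      qed
      then have "meval \<iota> h (vec n u) = meval \<iota> h (vec n v)" if "h \<in> A" for h
        using AInv that by (subst (1 2) vec_eq) (auto simp: Inv_eq)
      then have "meval \<iota> f (vec n u) = meval \<iota> f (vec n v)" if "f \<in> Inv" for f
        using assms(5) that unfolding geom_separating_def Inv_def by (meson vec_carrier)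
      then have *: "insertion \<iota> u f = insertion \<iota> v f" if "f \<in> Inv" for f
        using that vec_eq[of f u] vec_eq[of f v] by (simp add: Inv_eq)
      show ?thesis unfolding W12 a_def
      proof (rule invariants_separate_orbits[OF \<iota> alg_closed_infinite[OF ac] finW Wc])
        show "1\<^sub>m n \<in> W" using rho(2) by (force simp: W_def)
        show "bij_betw (\<lambda>M. M * N) W W" if "N \<in> W" for N
          using that unfolding W_def by (rule lin_rep_image_bij[OF assms(1,3)])
      qed (rule *, simp add: Inv_eq)
    qed
    have entries: "\<exists>i<n. \<exists>j<n. M $$ (i, j) - N $$ (i, j) \<noteq> 0" if MN: "M \<in> W1" "N \<in> W2" for M N
    proof (rule ccontr)
      assume eq: "\<not> ?thesis"
      have "M \<in> carrier_mat n n" "N \<in> carrier_mat n n" using MN W1W Wc by (auto simp: W2_def)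
      with eq have "M = N" by (intro eq_matI) auto
      with MN show False by (simp add: W2_def)
    qed
    show "\<exists>j<n. \<exists>i<n. a M i j - a N i j \<noteq> 0" if MN: "M \<in> W1" "N \<in> W2" for M N
    proof -
      obtain i j where ij: "i < n" "j < n" "M $$ (i, j) - N $$ (i, j) \<noteq> 0" using entries[OF MN] by blast
      then have "a M i j - a N i j \<noteq> 0" using injD[OF \<iota>_inj] by (auto simp: a_def)
      with ij show ?thesis by blast
    qed
    show "\<exists>x. (\<Sum>j<n. c j * x j) = 0 \<and> (\<exists>i<n. (\<Sum>j<n. (a M i j - a N i j) * x j) \<noteq> 0)"
      if MN: "M \<in> W1" "N \<in> W2" and c: "\<exists>j<n. c j \<noteq> 0" for M N c
    proof (rule ccontr)
      assume no: "\<not> ?thesis"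
      \<comment> \<open>Otherwise \<open>M - N\<close> vanishes on a hyperplane over the closure,
        hence on one over the small field, and \<open>inv \<sigma> \<otimes> \<tau>\<close> is a
        reflection; this puts \<open>\<tau>\<close> into the subgroup generated by
        reflections.\<close>
      define D where "D i j = M $$ (i, j) - N $$ (i, j)" for i j
      have ker: "(\<Sum>j<n. \<iota> (D i j) * x j) = 0" if "(\<Sum>j<n. c j * x j) = 0" "i < n" for x i
        using no that unfolding D_def a_def \<iota>.hom_minus by blast
      obtain i0 j0 where ij0: "i0 < n" "j0 < n" "D i0 j0 \<noteq> 0"
        using entries[OF MN] by (auto simp: D_def)
      obtain \<sigma> where \<sigma>: "\<sigma> \<in> generate G R" "M = \<rho> \<sigma>" using MN(1) by (auto simp: W1_def)
      obtain \<tau> where \<tau>: "\<tau> \<in> carrier G" "N = \<rho> \<tau>" using MN(2) by (auto simp: W2_def W_def)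
      have \<sigma>G: "\<sigma> \<in> carrier G" using \<sigma>(1) by (rule Hg.mem_carrier)
      have M: "M \<in> carrier_mat n n" and N: "N \<in> carrier_mat n n" using rho(1) \<sigma>G \<sigma>(2) \<tau> by auto
      have fix_u: "\<rho> (inv\<^bsub>G\<^esub> \<sigma> \<otimes>\<^bsub>G\<^esub> \<tau>) *\<^sub>v u = u"
        if u: "u \<in> carrier_vec n" "vec n (D i0) \<bullet> u = 0" for u
      proof -
        have "(\<Sum>j<n. D i0 j * u $ j) = 0"
          using u by (simp add: scalar_prod_def atLeast0LessThan)
        from hyperplane_descent[where D = D, OF \<iota> \<iota>_inj ij0 ker this]
        have "(\<Sum>j<n. D i j * u $ j) = 0" if "i < n" for i using that by blast
        then have "(\<Sum>j<n. M $$ (i, j) * u $ j) = (\<Sum>j<n. N $$ (i, j) * u $ j)" if "i < n" for i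
          using that by (simp add: D_def left_diff_distrib sum_subtractf)
        then have MNu: "M *\<^sub>v u = N *\<^sub>v u"
          using M N u(1) by (intro eq_vecI) (auto simp: scalar_prod_def atLeast0LessThan)
        have "\<rho> (inv\<^bsub>G\<^esub> \<sigma> \<otimes>\<^bsub>G\<^esub> \<tau>) *\<^sub>v u = \<rho> (inv\<^bsub>G\<^esub> \<sigma>) *\<^sub>v (N *\<^sub>v u)"
          using rho(1)[of "inv\<^bsub>G\<^esub> \<sigma>"] N \<sigma>G \<tau> u(1) by (simp add: rho(3) assoc_mult_mat_vec[of _ n n _ n])
        also have "\<dots> = (\<rho> (inv\<^bsub>G\<^esub> \<sigma>) * \<rho> \<sigma>) *\<^sub>v u"
          using rho(1)[of "inv\<^bsub>G\<^esub> \<sigma>"] M \<sigma>G \<sigma>(2) u(1)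
          by (simp add: MNu[symmetric] assoc_mult_mat_vec[of _ n n _ n])
        also have "\<rho> (inv\<^bsub>G\<^esub> \<sigma>) * \<rho> \<sigma> = 1\<^sub>m n"
          using rho(3)[of "inv\<^bsub>G\<^esub> \<sigma>" \<sigma>] \<sigma>G by (simp add: rho(2))
        also have "1\<^sub>m n *\<^sub>v u = u" using u(1) by simp
        finally show ?thesis .
      qed
      have "vec n (D i0) \<noteq> 0\<^sub>v n"
      proof
        assume "vec n (D i0) = 0\<^sub>v n"
        then have "vec n (D i0) $ j0 = 0\<^sub>v n $ j0" by simp
        with ij0 show False by simp
      qed
      then have "is_reflection G n \<rho> (inv\<^bsub>G\<^esub> \<sigma> \<otimes>\<^bsub>G\<^esub> \<tau>)"
        unfolding is_reflection_def using fix_u \<sigma>G \<tau>(1)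
        by (intro conjI bexI[of _ "vec n (D i0)"] ballI impI) auto
      then have "inv\<^bsub>G\<^esub> \<sigma> \<otimes>\<^bsub>G\<^esub> \<tau> \<in> generate G R"
        by (intro generate.incl) (simp add: R_def)
      with \<sigma>(1) have "\<sigma> \<otimes>\<^bsub>G\<^esub> (inv\<^bsub>G\<^esub> \<sigma> \<otimes>\<^bsub>G\<^esub> \<tau>) \<in> generate G R" by (rule Hg.m_closed)
      then have "\<tau> \<in> generate G R" using \<sigma>G \<tau>(1) by (simp add: m_assoc[symmetric])
      with \<tau>(2) MN(2) show False by (simp add: W2_def W1_def)
    qed
  qed
  then show False by (rule separated_maps.no_separation[OF _ W1_ne W2_ne])
qed

end
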